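(* For every $p\in(2,+\infty]$ there is a positive constant $c(p)$, depending only on $p$, such that the following holds. Let $X\in C^4(B,\mathbb R^4)$ be a conformally parametrized immersion of the closed unit disc $B$, let $S$ be the curvature of its normal bundle, and put $s_p:=\|S\|_{L_p(B)}$. If $\{N_1,N_2\}$ is a critical orthonormal normal section of $X$ with torsion coefficients $T_{1,1}^2,T_{1,2}^2$, then the complex-valued torsion $\Psi:=T_{1,1}^2-iT_{1,2}^2$ satisfies $$|\Psi(w)|\le c(p)\,s_p\quad\text{for all } w\in B.$$
   Context: $B=\{(u,v)\in\mathbb R^2: u^2+v^2\le 1\}$ is the closed unit disc, identified with a subset of $\mathbb C$ via $w=u+iv$. A conformally parametrized immersion is a map $X\in C^4(B,\mathbb R^4)$ with $|X_u|^2=|X_v|^2=:W>0$ and $X_u\cdot X_v=0$ in $B$. An orthonormal normal section of $X$ is a pair $N_1,N_2\in C^3(B,\mathbb R^4)$ with $X_u\cdot N_\sigma=X_v\cdot N_\sigma=0$, $|N_1|=|N_2|=1$, $N_1\cdot N_2=0$ in $B$. Torsion coefficients: $T_{1,1}^2:=N_{1,u}\cdot N_2$, $T_{1,2}^2:=N_{1,v}\cdot N_2$ (subscripts $u,v$ denote partial derivatives). The curvature of the normal bundle is $S:=\partial_v T_{1,1}^2-\partial_u T_{1,2}^2$; it does not depend on the section within the class of sections related by rotations $\widetilde N_1=\cos\varphi\,N_1+\sin\varphi\,N_2$, $\widetilde N_2=-\sin\varphi\,N_1+\cos\varphi\,N_2$ (and $|S|$ does not depend on the section at all). Total torsion: $\mathcal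 T_X(N_1,N_2):=2\iint_B\{(T_{1,1}^2)^2+(T_{1,2}^2)^2\}\,du\,dv$. The section $\{N_1,N_2\}$ is critical if for every $\varphi\in C^3(B,\mathbb R)$ the function $t\mapsto\mathcal T_X(\cos(t\varphi)N_1+\sin(t\varphi)N_2,\,-\sin(t\varphi)N_1+\cos(t\varphi)N_2)$ has vanishing derivative at $t=0$. *)

theory Defs
  imports "HOL-Analysis.Analysis" "HOL-Probability.Essential_Supremum"
begin

abbreviation disc :: "complex set" where
  "disc \<equiv> cball 0 1"

text \<open>
  Partial derivatives with respect to u and v, where w = u + iv, are taken up to the boundary
  of the closed disc by evaluating the Frechet derivative relative to the disc, which is unique
  at every point of the disc, in the directions 1 and i. A one-dimensional derivative along a
  coordinate line would not do: at w = 1, for example, the vertical line meets the disc in a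
  single point.
\<close>

definition pd_u :: "(complex \<Rightarrow> 'a::real_normed_vector) \<Rightarrow> complex \<Rightarrow> 'a" where
  "pd_u f w = frechet_derivative f (at w within disc) 1"

definition pd_v :: "(complex \<Rightarrow> 'a::real_normed_vector) \<Rightarrow> complex \<Rightarrow> 'a" where
  "pd_v f w = frechet_derivative f (at w within disc) \<i>"

text \<open>
  The class C^k on the closed disc. As the disc is convex with nonempty interior, this is the
  usual class of functions that are C^k in the interior and whose derivatives up to order k
  extend continuously to the boundary. Values outside the disc are irrelevant.
\<close>

primrec C_disc :: "nat \<Rightarrow> (complex \<Rightarrow> 'a::real_normed_vector) \<Rightarrow> bool" where
  "C_disc 0 f \<longleftrightarrow> continuous_on disc f"
| "C_disc (Suc k) f \<longleftrightarrow>
     (\<forall>w\<in>disc. f differentiable (at w within disc)) \<and> C_disc k (pd_u f) \<and> C_disc k (pd_v f)"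

definition conformal_immersion :: "(complex \<Rightarrow> real ^ 4) \<Rightarrow> bool" where
  "conformal_immersion X \<longleftrightarrow> C_disc 4 X \<and>
     (\<forall>w\<in>disc. (norm (pd_u X w))\<^sup>2 = (norm (pd_v X w))\<^sup>2 \<and>
               (norm (pd_u X w))\<^sup>2 > 0 \<and>
               pd_u X w \<bullet> pd_v X w = 0)"

definition orthonormal_normal_section ::
    "(complex \<Rightarrow> real ^ 4) \<Rightarrow> (complex \<Rightarrow> real ^ 4) \<Rightarrow> (complex \<Rightarrow> real ^ 4) \<Rightarrow> bool" where
  "orthonormal_normal_section X N1 N2 \<longleftrightarrow> C_disc 3 N1 \<and> C_disc 3 N2 \<and>
     (\<forall>w\<in>disc. pd_u X w \<bullet> N1 w = 0 \<and> pd_v X w \<bullet> N1 w = 0 \<and>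
               pd_u X w \<bullet> N2 w = 0 \<and> pd_v X w \<bullet> N2 w = 0 \<and>
               norm (N1 w) = 1 \<and> norm (N2 w) = 1 \<and> N1 w \<bullet> N2 w = 0)"

definition torsion_u :: "(complex \<Rightarrow> real ^ 4) \<Rightarrow> (complex \<Rightarrow> real ^ 4) \<Rightarrow> complex \<Rightarrow> real" where
  "torsion_u N1 N2 w = pd_u N1 w \<bullet> N2 w"

definition torsion_v :: "(complex \<Rightarrow> real ^ 4) \<Rightarrow> (complex \<Rightarrow> real ^ 4) \<Rightarrow> complex \<Rightarrow> real" where
  "torsion_v N1 N2 w = pd_v N1 w \<bullet> N2 w"

definition normal_curvature ::
    "(complex \<Rightarrow> real ^ 4) \<Rightarrow> (complex \<Rightarrow> real ^ 4) \<Rightarrow> complex \<Rightarrow> real" where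
  "normal_curvature N1 N2 w = pd_v (torsion_u N1 N2) w - pd_u (torsion_v N1 N2) w"

definition complex_torsion ::
    "(complex \<Rightarrow> real ^ 4) \<Rightarrow> (complex \<Rightarrow> real ^ 4) \<Rightarrow> complex \<Rightarrow> complex" where
  "complex_torsion N1 N2 w =
     complex_of_real (torsion_u N1 N2 w) - \<i> * complex_of_real (torsion_v N1 N2 w)"

definition total_torsion :: "(complex \<Rightarrow> real ^ 4) \<Rightarrow> (complex \<Rightarrow> real ^ 4) \<Rightarrow> real" where
  "total_torsion N1 N2 =
     2 * (LINT w:disc|lborel. (torsion_u N1 N2 w)\<^sup>2 + (torsion_v N1 N2 w)\<^sup>2)"

definition critical_normal_section ::
    "(complex \<Rightarrow> real ^ 4) \<Rightarrow> (complex \<Rightarrow> real ^ 4) \<Rightarrow> (complex \<Rightarrow> real ^ 4) \<Rightarrow> bool" where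
  "critical_normal_section X N1 N2 \<longleftrightarrow> orthonormal_normal_section X N1 N2 \<and>
     (\<forall>\<phi> :: complex \<Rightarrow> real. C_disc 3 \<phi> \<longrightarrow>
        ((\<lambda>t. total_torsion
                (\<lambda>w. cos (t * \<phi> w) *\<^sub>R N1 w + sin (t * \<phi> w) *\<^sub>R N2 w)
                (\<lambda>w. - sin (t * \<phi> w) *\<^sub>R N1 w + cos (t * \<phi> w) *\<^sub>R N2 w))
           has_real_derivative 0) (at 0))"

text \<open>
  The norm of L_p over the disc, for p in [1,\<infinity>]. It is real-valued, hence meaningful only for
  functions in L_p; it is applied below to the normal curvature, which is continuous on the
  closed disc because the sections are of class C^3.
\<close>

definition Lp_norm_disc :: "ereal \<Rightarrow> (complex \<Rightarrow> real) \<Rightarrow> real" where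
  "Lp_norm_disc p f =
     (if p = \<infinity> then real_of_ereal (esssup (restrict_space lborel disc) (\<lambda>w. ereal \<bar>f w\<bar>))
      else (LINT w:disc|lborel. \<bar>f w\<bar> powr real_of_ereal p) powr (1 / real_of_ereal p))"

end

theory Submission imports Defs begin

text \<open>
  Put a = \<open>torsion_u\<close>, b = \<open>torsion_v\<close> and \<open>\<Psi> = a - i b\<close>. Rotating the section by \<open>t \<phi>\<close> adds \<open>t \<nabla>\<phi>\<close>
  to (a, b), so criticality says that (a, b) is orthogonal in \<open>L\<^sup>2\<close> to all gradients. For F real on
  the unit circle, this and the divergence theorem applied to a Im F and b Im F give
  \<open>Re \<integral> \<Psi> (F\<^sub>u + i F\<^sub>v) = \<integral> S Im F\<close>. Taking for F a regularised Cauchy kernel with pole w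
  plus its reflection in the circle and letting the regularisation tend to zero bounds
  \<open>|\<Psi>(w)|\<close>, for w in the open disc, by a constant times \<open>\<integral> |S(z)| / |z - w|\<close>. Hoelder's
  inequality with the conjugate exponent q < 2, for which \<open>|z - w| powr (-q)\<close> is integrable
  uniformly in w, bounds this integral, and continuity extends the estimate to the circle.
\<close>

subsection \<open>Calculus of functions of class C^k on the closed disc\<close>

text \<open>Criticality controls the divergence of (a, b) and S its curl, and together they see only
  the real part of \<open>\<Psi>\<close> times a dbar-derivative. Hence the complex weight
  \<open>l\<close> in \<open>test_fun\<close>: taken as the conjugate of \<open>\<Psi>\<close> at w,
  it turns that real part into the square of the modulus. The obstacle is the circle. Rotation
  angles are free there, so Re F is unrestricted, but integrating by parts against Im F needs Im F =
  0, which a Cauchy kernel alone violates. The reflected summand repairs this at little cost: its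
  singularity lies outside the closed disc, so its dbar-derivative dies in the limit for fixed
  interior w, and its size never exceeds the bound for the original kernel. Test functions must be
  of class C^3, hence the regularisation conj(z) / (|z|^2 + e^2); its dbar-derivative is an explicit
  positive function whose mass over the plane does not depend on e, so the limit is an approximate
  identity and no contour around the pole is cut out. The final constant is C /
  \<open>\<kappa>\<close>, with C from the kernel estimate and \<open>\<kappa>\<close> that
  mass.\<close>

lemma bounded_linear_zero_on_disc_diff:
  fixes L :: "complex \<Rightarrow> 'a::real_normed_vector"
  assumes L: "bounded_linear L" and w: "w \<in> disc" and 0: "\<And>y. y \<in> disc \<Longrightarrow> L (y - w) = 0"
  shows "L = (\<lambda>_. 0)"
proof
  interpret L: bounded_linear L by fact
  \<comment> \<open>The centre 0 lies in \<open>disc\<close>; it turns vanishing on the differences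
    \<open>y - w\<close> into vanishing on \<open>disc\<close> itself, and rescaling then reaches
    every vector.\<close>
  have "L w = 0" using 0[of 0] L.neg[of w] by simp
  then have ball: "L y = 0" if "y \<in> disc" for y using 0[OF that] by (simp add: L.diff)
  fix y
  show "L y = 0"
  proof (cases "y = 0")
    case False
    have "L (inverse (norm y) *\<^sub>R y) = 0" using False by (intro ball) simp
    then show ?thesis using False by (simp add: L.scaleR)
  qed (simp add: L.zero)
qed

text \<open>At a boundary point a coordinate direction can leave the disc at once. The derivatives
  are therefore compared along the segments from w to points y of the disc, which stay inside by
  convexity; the directions \<open>y - w\<close> span the plane.\<close>

lemma has_derivative_disc_unique:
  fixes f :: "complex \<Rightarrow> 'a::real_normed_vector"
  assumes f: "(f has_derivative f') (at w within disc)" "(f has_derivative f'') (at w within disc)"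
    and w: "w \<in> disc"
  shows "f' = f''"
proof -
  have dir: "((\<lambda>t. f (w + t *\<^sub>R (y - w))) has_vector_derivative D (y - w)) (at 0 within {0..1})"
    if D: "(f has_derivative D) (at w within disc)" and y: "y \<in> disc" for D y
  proof -
    have sub: "(\<lambda>t. w + t *\<^sub>R (y - w)) ` {0..1} \<subseteq> disc"
    proof safe
      fix t :: real assume "t \<in> {0..1}"
      then have "(1 - t) *\<^sub>R w + t *\<^sub>R y \<in> disc"
        using w y by (intro convexD[OF convex_cball]) auto
      then show "w + t *\<^sub>R (y - w) \<in> disc" by (simp add: algebra_simps)
    qed
    have g: "((\<lambda>t. w + t *\<^sub>R (y - w)) has_derivative (\<lambda>t. t *\<^sub>R (y - w))) (at 0 within {0..1::real})"
      by (auto intro!: derivative_eq_intros)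
    interpret D: bounded_linear D using D by (rule has_derivative_bounded_linear)
    have "(f has_derivative D) (at ((\<lambda>t. w + t *\<^sub>R (y - w)) 0) within (\<lambda>t. w + t *\<^sub>R (y - w)) ` {0..1})"
      using has_derivative_subset[OF D sub] by simp
    from has_derivative_in_compose[OF g this] show ?thesis
      by (simp add: has_vector_derivative_def D.scaleR)
  qed
  have eq: "f' (y - w) = f'' (y - w)" if "y \<in> disc" for y
    using dir[OF f(1) that] dir[OF f(2) that]
    by (intro vector_derivative_unique_within[OF _ dir[OF f(1) that] dir[OF f(2) that]])
       (simp add: at_within_Icc_at_right)
  have "(\<lambda>h. f' h - f'' h) = (\<lambda>_. 0)"
    using f by (intro bounded_linear_zero_on_disc_diff[OF _ w] bounded_linear_sub)
      (auto simp: has_derivative_bounded_linear eq)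
  then show ?thesis by (metis eq_iff_diff_eq_0 ext)
qed

lemma pd_eqI:
  assumes "(f has_derivative f') (at w within disc)" "w \<in> disc"
  shows "pd_u f w = f' 1" "pd_v f w = f' \<i>"
proof -
  have "frechet_derivative f (at w within disc) = f'"
    using assms has_derivative_disc_unique frechet_derivative_works differentiableI by blast
  then show "pd_u f w = f' 1" "pd_v f w = f' \<i>" by (simp_all add: pd_u_def pd_v_def)
qed

lemma differentiable_disc_has_derivative:
  fixes f :: "complex \<Rightarrow> 'a::real_normed_vector"
  assumes "f differentiable (at w within disc)"
  shows "(f has_derivative (\<lambda>h. Re h *\<^sub>R pd_u f w + Im h *\<^sub>R pd_v f w)) (at w within disc)"
proof -
  let ?D = "frechet_derivative f (at w within disc)"
  have D: "(f has_derivative ?D) (at w within disc)"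
    using assms frechet_derivative_works by blast
  then interpret bounded_linear ?D by (rule has_derivative_bounded_linear)
  have "?D h = Re h *\<^sub>R pd_u f w + Im h *\<^sub>R pd_v f w" for h
  proof -
    have "h = Re h *\<^sub>R 1 + Im h *\<^sub>R \<i>" by (simp add: complex_eq_iff)
    then have "?D h = ?D (Re h *\<^sub>R 1 + Im h *\<^sub>R \<i>)" by simp
    then show ?thesis unfolding add scaleR by (simp add: pd_u_def pd_v_def)
  qed
  with D show ?thesis by (metis (no_types, lifting) ext)
qed

text \<open>A derivative within \<open>disc\<close> sees only values on \<open>disc\<close>. This
  lets \<open>C_disc_SucI\<close> replace the partial derivatives by formulas that are valid on the
  disc alone.\<close>

lemma C_disc_cong:
  fixes f g :: "complex \<Rightarrow> 'a::real_normed_vector"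
  assumes "\<And>w. w \<in> disc \<Longrightarrow> f w = g w"
  shows "C_disc k f \<longleftrightarrow> C_disc k g"
  using assms
proof (induction k arbitrary: f g)
  case 0
  then show ?case using continuous_on_cong[of disc disc f g] by simp
next
  case (Suc k)
  have one: "C_disc (Suc k) g" if fg: "\<And>w. w \<in> disc \<Longrightarrow> f w = g w" and C: "C_disc (Suc k) f"
    for f g :: "complex \<Rightarrow> 'a"
  proof -
    have f: "(f has_derivative (\<lambda>h. Re h *\<^sub>R pd_u f w + Im h *\<^sub>R pd_v f w)) (at w within disc)"
      if "w \<in> disc" for w
      using C that by (intro differentiable_disc_has_derivative) simp
    have g: "(g has_derivative (\<lambda>h. Re h *\<^sub>R pd_u f w + Im h *\<^sub>R pd_v f w)) (at w within disc)"
      if "w \<in> disc" for w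
      by (rule has_derivative_transform[OF that fg[symmetric] f[OF that]])
    have "pd_u f w = pd_u g w" "pd_v f w = pd_v g w" if "w \<in> disc" for w
      using pd_eqI[OF g[OF that] that] by simp_all
    then have "C_disc k (pd_u g)" "C_disc k (pd_v g)"
      using Suc.IH[of "pd_u f" "pd_u g"] Suc.IH[of "pd_v f" "pd_v g"] C by simp_all
    then show ?thesis using g unfolding C_disc.simps differentiable_def by blast
  qed
  show ?case using one[of f g] one[of g f] Suc.prems by metis
qed

lemma C_disc_SucI:
  assumes "\<And>w. w \<in> disc \<Longrightarrow> (f has_derivative D w) (at w within disc)"
    and "C_disc k (\<lambda>w. D w 1)" "C_disc k (\<lambda>w. D w \<i>)"
  shows "C_disc (Suc k) f"
  using assms pd_eqI[OF assms(1)]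
    C_disc_cong[of "pd_u f" "\<lambda>w. D w 1"] C_disc_cong[of "pd_v f" "\<lambda>w. D w \<i>"]
  unfolding C_disc.simps differentiable_def by blast

lemma C_disc_has_derivative:
  assumes "C_disc (Suc k) f" "w \<in> disc"
  shows "(f has_derivative (\<lambda>h. Re h *\<^sub>R pd_u f w + Im h *\<^sub>R pd_v f w)) (at w within disc)"
  using assms by (intro differentiable_disc_has_derivative) simp

lemma C_disc_SucD: "C_disc (Suc k) f \<Longrightarrow> C_disc k f"
proof (induction k arbitrary: f)
  case 0
  then show ?case
    by (auto simp: continuous_on_eq_continuous_within intro: differentiable_imp_continuous_within)
next
  case (Suc k)
  have "C_disc k (pd_u f)" "C_disc k (pd_v f)"
    using Suc.prems by (auto intro: Suc.IH simp only: C_disc.simps(2)[of "Suc k"])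
  then show ?case using Suc.prems by simp
qed

lemma C_disc_mono: "C_disc k f \<Longrightarrow> j \<le> k \<Longrightarrow> C_disc j f"
  by (induction k) (auto simp: le_Suc_eq simp del: C_disc.simps dest: C_disc_SucD)

lemma C_disc_imp_continuous_on: "C_disc k f \<Longrightarrow> continuous_on disc f"
  using C_disc_mono[of k f 0] by simp

lemma C_disc_const: "C_disc k (\<lambda>_. c)"
proof (induction k arbitrary: c)
  case (Suc k)
  show ?case by (rule C_disc_SucI[where D = "\<lambda>_ _. 0"]) (auto intro: Suc)
qed simp

lemma C_disc_bounded_linear:
  assumes "bounded_linear L" "C_disc k f"
  shows "C_disc k (\<lambda>w. L (f w))"
  using assms(2)
proof (induction k arbitrary: f)
  case 0
  then show ?case using assms(1) by (simp add: bounded_linear.continuous_on)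
next
  case (Suc k)
  interpret bounded_linear L by fact
  show ?case
    using Suc by (intro C_disc_SucI[OF has_derivative[OF C_disc_has_derivative[OF Suc.prems]]]) auto
qed

lemma C_disc_add:
  assumes "C_disc k f" "C_disc k g"
  shows "C_disc k (\<lambda>w. f w + g w)"
  using assms
proof (induction k arbitrary: f g)
  case 0
  then show ?case by (simp add: continuous_on_add)
next
  case (Suc k)
  show ?case
    using Suc by (intro C_disc_SucI[OF has_derivative_add[OF Suc.prems[THEN C_disc_has_derivative]]]) auto
qed

lemma C_disc_bounded_bilinear:
  assumes "bounded_bilinear B" "C_disc k f" "C_disc k g"
  shows "C_disc k (\<lambda>w. B (f w) (g w))"
  using assms(2,3)
proof (induction k arbitrary: f g)
  case 0
  then show ?case using assms(1) by (simp add: bounded_bilinear.continuous_on)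
next
  case (Suc k)
  show ?case
    using Suc C_disc_SucD[OF Suc.prems(1)] C_disc_SucD[OF Suc.prems(2)]
    by (intro C_disc_SucI[OF bounded_bilinear.FDERIV[OF assms(1) Suc.prems[THEN C_disc_has_derivative]]])
       (auto intro!: C_disc_add)
qed

lemmas C_disc_mult = C_disc_bounded_bilinear[OF bounded_bilinear_mult]
lemmas C_disc_inner = C_disc_bounded_bilinear[OF bounded_bilinear_inner]

lemma C_disc_minus: "C_disc k f \<Longrightarrow> C_disc k (\<lambda>w. - f w)"
  by (rule C_disc_bounded_linear[OF bounded_linear_minus[OF bounded_linear_ident]])

lemma C_disc_ident: "C_disc k (\<lambda>w. w)"
proof (cases k)
  case (Suc j)
  show ?thesis unfolding Suc
    by (rule C_disc_SucI[where D = "\<lambda>_ h. h"]) (auto intro: C_disc_const)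
qed simp

text \<open>The derivative of \<open>inverse f\<close> contains \<open>inverse f\<close> again,
  which has class \<open>k\<close> by the induction hypothesis; so the induction keeps
  \<open>f\<close> fixed.\<close>

lemma C_disc_inverse:
  fixes f :: "complex \<Rightarrow> 'a::real_normed_field"
  assumes "C_disc k f" and nz: "\<And>w. w \<in> disc \<Longrightarrow> f w \<noteq> 0"
  shows "C_disc k (\<lambda>w. inverse (f w))"
  using assms(1)
proof (induction k)
  case 0
  then show ?case using nz by (auto intro: continuous_on_inverse)
next
  case (Suc k)
  have inv: "C_disc k (\<lambda>w. inverse (f w))" by (rule Suc.IH[OF C_disc_SucD[OF Suc.prems]])
  have D: "((\<lambda>w. inverse (f w)) has_derivative
      (\<lambda>h. - (inverse (f w) * (Re h *\<^sub>R pd_u f w + Im h *\<^sub>R pd_v f w) * inverse (f w))))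
      (at w within disc)" if "w \<in> disc" for w
    using nz that by (intro Deriv.has_derivative_inverse C_disc_has_derivative[OF Suc.prems])
  have "C_disc k (pd_u f)" "C_disc k (pd_v f)" using Suc.prems by simp_all
  note this[THEN C_disc_mult[OF inv], THEN C_disc_mult[OF _ inv], THEN C_disc_minus]
  then show ?case by (intro C_disc_SucI[OF D]) simp_all
qed

lemma pd_add:
  assumes "C_disc (Suc k) f" "C_disc (Suc j) g" "w \<in> disc"
  shows "pd_u (\<lambda>w. f w + g w) w = pd_u f w + pd_u g w" "pd_v (\<lambda>w. f w + g w) w = pd_v f w + pd_v g w"
  using pd_eqI[OF has_derivative_add[OF C_disc_has_derivative[OF assms(1,3)] C_disc_has_derivative[OF assms(2,3)]] assms(3)]
  by simp_all

lemma pd_mult: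
  fixes f g :: "complex \<Rightarrow> 'a::real_normed_algebra"
  assumes "C_disc (Suc k) f" "C_disc (Suc j) g" "w \<in> disc"
  shows "pd_u (\<lambda>w. f w * g w) w = f w * pd_u g w + pd_u f w * g w"
    "pd_v (\<lambda>w. f w * g w) w = f w * pd_v g w + pd_v f w * g w"
  using pd_eqI[OF has_derivative_mult[OF C_disc_has_derivative[OF assms(1,3)] C_disc_has_derivative[OF assms(2,3)]] assms(3)]
  by simp_all

lemma pd_bounded_linear:
  assumes "bounded_linear L" "C_disc (Suc k) f" "w \<in> disc"
  shows "pd_u (\<lambda>w. L (f w)) w = L (pd_u f w)" "pd_v (\<lambda>w. L (f w)) w = L (pd_v f w)"
  using pd_eqI[OF bounded_linear.has_derivative[OF assms(1) C_disc_has_derivative[OF assms(2,3)]] assms(3)]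
  by simp_all

subsection \<open>Torsion and rotations of the section\<close>

lemma set_integrable_disc:
  fixes f :: "complex \<Rightarrow> 'b::{banach, second_countable_topology}"
  shows "continuous_on disc f \<Longrightarrow> set_integrable lborel disc f"
  unfolding set_integrable_def by (rule borel_integrable_compact[OF compact_cball])

lemma pd_inner_const:
  assumes f: "C_disc (Suc k) f" and g: "C_disc (Suc k) g"
    and c: "\<And>w. w \<in> disc \<Longrightarrow> f w \<bullet> g w = c" and w: "w \<in> disc"
  shows "f w \<bullet> pd_u g w + pd_u f w \<bullet> g w = 0" "f w \<bullet> pd_v g w + pd_v f w \<bullet> g w = 0"
proof -
  have 1: "((\<lambda>w. f w \<bullet> g w) has_derivative (\<lambda>_. 0)) (at w within disc)"
    using c w by (intro has_derivative_transform[OF w _ has_derivative_const[of c]]) auto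
  note 2 = has_derivative_inner[OF C_disc_has_derivative[OF f w] C_disc_has_derivative[OF g w]]
  show "f w \<bullet> pd_u g w + pd_u f w \<bullet> g w = 0" "f w \<bullet> pd_v g w + pd_v f w \<bullet> g w = 0"
    using pd_eqI[OF 1 w] pd_eqI[OF 2 w] by simp_all
qed

text \<open>The torsion is the connection form of the normal bundle, and rotations of the plane
  commute: a change of gauge by the angle \<open>t * \<phi>\<close> adds the exact form t
  d\<open>\<phi>\<close>, with no further dependence on the angle.\<close>

lemma torsion_rotate:
  fixes N1 N2 :: "complex \<Rightarrow> real ^ 4" and \<phi> :: "complex \<Rightarrow> real" and t :: real
  assumes N: "orthonormal_normal_section X N1 N2" and \<phi>: "C_disc (Suc k) \<phi>" and w: "w \<in> disc"
  defines "M1 \<equiv> \<lambda>w. cos (t * \<phi> w) *\<^sub>R N1 w + sin (t * \<phi> w) *\<^sub>R N2 w"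
    and "M2 \<equiv> \<lambda>w. - sin (t * \<phi> w) *\<^sub>R N1 w + cos (t * \<phi> w) *\<^sub>R N2 w"
  shows "torsion_u M1 M2 w = torsion_u N1 N2 w + t * pd_u \<phi> w"
    and "torsion_v M1 M2 w = torsion_v N1 N2 w + t * pd_v \<phi> w"
proof -
  have C: "C_disc (Suc 2) N1" "C_disc (Suc 2) N2"
    and on: "\<And>w. w \<in> disc \<Longrightarrow> N1 w \<bullet> N1 w = 1" "\<And>w. w \<in> disc \<Longrightarrow> N2 w \<bullet> N2 w = 1"
      "\<And>w. w \<in> disc \<Longrightarrow> N1 w \<bullet> N2 w = 0"
    using N unfolding orthonormal_normal_section_def eval_nat_numeral by (auto simp: dot_square_norm)
  note i = pd_inner_const[OF C(1,1) on(1) w] pd_inner_const[OF C(2,2) on(2) w]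
    pd_inner_const[OF C on(3) w]
  note on_w = on[OF w]
  define c s where "c = cos (t * \<phi> w)" and "s = sin (t * \<phi> w)"
  have cs: "c * c + s * s = 1"
    by (simp add: c_def s_def flip: power2_eq_square)
  have "(M1 has_derivative
      (\<lambda>h. (c *\<^sub>R (Re h *\<^sub>R pd_u N1 w + Im h *\<^sub>R pd_v N1 w)
          - (t * (Re h * pd_u \<phi> w + Im h * pd_v \<phi> w) * s) *\<^sub>R N1 w)
        + (s *\<^sub>R (Re h *\<^sub>R pd_u N2 w + Im h *\<^sub>R pd_v N2 w)
          + (t * (Re h * pd_u \<phi> w + Im h * pd_v \<phi> w) * c) *\<^sub>R N2 w))) (at w within disc)"
    unfolding M1_def c_def s_def
    by (rule derivative_eq_intros C_disc_has_derivative[OF C(1) w] C_disc_has_derivative[OF C(2) w]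
        C_disc_has_derivative[OF \<phi> w] refl)+ (simp add: fun_eq_iff algebra_simps)
  note pd = pd_eqI[OF this w]
  have M2: "M2 w = c *\<^sub>R N2 w - s *\<^sub>R N1 w" by (simp add: M2_def c_def s_def)
  \<comment> \<open>One computation for both directions: \<open>A\<close> and \<open>B\<close> stand
    for a partial derivative of \<open>N1\<close> and \<open>N2\<close>, \<open>x\<close> for that
    of \<open>t * \<phi>\<close>; the premises are the differentiated orthonormality
    relations.\<close>
  have alg: "(c *\<^sub>R A - (x * s) *\<^sub>R N1 w + (s *\<^sub>R B + (x * c) *\<^sub>R N2 w)) \<bullet> (c *\<^sub>R N2 w - s *\<^sub>R N1 w)
      = A \<bullet> N2 w + x"
    if "N1 w \<bullet> A + A \<bullet> N1 w = 0" "N2 w \<bullet> B + B \<bullet> N2 w = 0" "N1 w \<bullet> B + A \<bullet> N2 w = 0" for A B x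
  proof -
    have z: "A \<bullet> N1 w = 0" "B \<bullet> N2 w = 0" "B \<bullet> N1 w = - (A \<bullet> N2 w)" "N2 w \<bullet> N1 w = 0"
      using that on_w by (simp_all add: inner_commute)
    have "(c *\<^sub>R A - (x * s) *\<^sub>R N1 w + (s *\<^sub>R B + (x * c) *\<^sub>R N2 w)) \<bullet> (c *\<^sub>R N2 w - s *\<^sub>R N1 w)
        = (c * c + s * s) * (A \<bullet> N2 w + x)"
      by (simp add: inner_add_left inner_diff_left inner_add_right inner_diff_right z on_w algebra_simps)
    then show ?thesis using cs by simp
  qed
  show "torsion_u M1 M2 w = torsion_u N1 N2 w + t * pd_u \<phi> w"
    using alg[of "pd_u N1 w" "pd_u N2 w" "t * pd_u \<phi> w"] i by (simp add: torsion_u_def pd M2)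
  show "torsion_v M1 M2 w = torsion_v N1 N2 w + t * pd_v \<phi> w"
    using alg[of "pd_v N1 w" "pd_v N2 w" "t * pd_v \<phi> w"] i by (simp add: torsion_v_def pd M2)
qed

lemma C_disc_torsion:
  assumes "orthonormal_normal_section X N1 N2"
  shows "C_disc 2 (torsion_u N1 N2)" "C_disc 2 (torsion_v N1 N2)"
proof -
  have C: "C_disc (Suc 2) N1" "C_disc (Suc 2) N2"
    using assms unfolding orthonormal_normal_section_def eval_nat_numeral by auto
  then have "C_disc 2 (pd_u N1)" "C_disc 2 (pd_v N1)" "C_disc 2 N2"
    using C_disc.simps(2)[of 2 N1] C_disc_SucD[of 2 N2] by blast+
  then show "C_disc 2 (torsion_u N1 N2)" "C_disc 2 (torsion_v N1 N2)"
    unfolding torsion_u_def[abs_def] torsion_v_def[abs_def] by (auto intro: C_disc_inner)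
qed

lemma continuous_on_complex_torsion:
  assumes "orthonormal_normal_section X N1 N2"
  shows "continuous_on disc (complex_torsion N1 N2)"
  unfolding complex_torsion_def[abs_def]
  by (intro continuous_intros C_disc_torsion[OF assms, THEN C_disc_imp_continuous_on])

lemma continuous_on_normal_curvature:
  assumes "orthonormal_normal_section X N1 N2"
  shows "continuous_on disc (normal_curvature N1 N2)"
proof -
  have "C_disc (Suc (Suc 0)) (torsion_u N1 N2)" "C_disc (Suc (Suc 0)) (torsion_v N1 N2)"
    using C_disc_torsion[OF assms] unfolding eval_nat_numeral by auto
  then have "C_disc (Suc 0) (pd_v (torsion_u N1 N2))" "C_disc (Suc 0) (pd_u (torsion_v N1 N2))"
    using C_disc.simps(2)[of "Suc 0"] by blast+
  then show ?thesis
    unfolding normal_curvature_def[abs_def] by (intro continuous_intros C_disc_imp_continuous_on)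
qed

text \<open>By \<open>torsion_rotate\<close> the total torsion along the variation is exactly a
  quadratic polynomial in t, so its derivative at 0 is read off without differentiating under the
  integral. As \<open>\<phi>\<close> is free on the circle, the identity also encodes the natural
  boundary condition: (a, b) has no normal component there.\<close>

lemma critical_imp_weakly_divergence_free:
  assumes crit: "critical_normal_section X N1 N2" and \<phi>: "C_disc 3 \<phi>"
  shows "(LINT w:disc|lborel. torsion_u N1 N2 w * pd_u \<phi> w + torsion_v N1 N2 w * pd_v \<phi> w) = 0"
proof -
  let ?a = "torsion_u N1 N2" and ?b = "torsion_v N1 N2"
  let ?T = "\<lambda>t. total_torsion
                (\<lambda>w. cos (t * \<phi> w) *\<^sub>R N1 w + sin (t * \<phi> w) *\<^sub>R N2 w)
                (\<lambda>w. - sin (t * \<phi> w) *\<^sub>R N1 w + cos (t * \<phi> w) *\<^sub>R N2 w)"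
  have N: "orthonormal_normal_section X N1 N2" and T0: "(?T has_real_derivative 0) (at 0)"
    using crit \<phi> by (auto simp: critical_normal_section_def)
  have \<phi>': "C_disc (Suc 2) \<phi>" using \<phi> by (simp add: eval_nat_numeral)
  have cont: "continuous_on disc ?a" "continuous_on disc ?b"
    "continuous_on disc (pd_u \<phi>)" "continuous_on disc (pd_v \<phi>)"
    using C_disc_torsion[OF N] \<phi>' by (auto intro: C_disc_imp_continuous_on simp only: C_disc.simps(2)[of 2 \<phi>])
  define I0 I1 I2 where "I0 = (LINT w:disc|lborel. (?a w)\<^sup>2 + (?b w)\<^sup>2)"
    and "I1 = (LINT w:disc|lborel. ?a w * pd_u \<phi> w + ?b w * pd_v \<phi> w)"
    and "I2 = (LINT w:disc|lborel. (pd_u \<phi> w)\<^sup>2 + (pd_v \<phi> w)\<^sup>2)"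
  have "?T t = 2 * (I0 + (2 * t) * I1 + t\<^sup>2 * I2)" for t
  proof -
    have "?T t = 2 * (LINT w:disc|lborel. (?a w + t * pd_u \<phi> w)\<^sup>2 + (?b w + t * pd_v \<phi> w)\<^sup>2)"
      unfolding total_torsion_def
      by (intro arg_cong2[where f = "(*)"] refl set_lebesgue_integral_cong ballI allI impI, simp)
        (simp only: torsion_rotate[OF N \<phi>'])
    also have "(LINT w:disc|lborel. (?a w + t * pd_u \<phi> w)\<^sup>2 + (?b w + t * pd_v \<phi> w)\<^sup>2) =
        (LINT w:disc|lborel. ((?a w)\<^sup>2 + (?b w)\<^sup>2) + (2 * t) * (?a w * pd_u \<phi> w + ?b w * pd_v \<phi> w)
          + t\<^sup>2 * ((pd_u \<phi> w)\<^sup>2 + (pd_v \<phi> w)\<^sup>2))"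
      by (intro set_lebesgue_integral_cong) (auto simp: power2_eq_square algebra_simps)
    also have "\<dots> = I0 + (2 * t) * I1 + t\<^sup>2 * I2"
    proof -
      have "set_integrable lborel disc (\<lambda>w. (?a w)\<^sup>2 + (?b w)\<^sup>2)"
        "set_integrable lborel disc (\<lambda>w. (2 * t) * (?a w * pd_u \<phi> w + ?b w * pd_v \<phi> w))"
        "set_integrable lborel disc (\<lambda>w. t\<^sup>2 * ((pd_u \<phi> w)\<^sup>2 + (pd_v \<phi> w)\<^sup>2))"
        by (intro set_integrable_disc continuous_intros cont)+
      then show ?thesis unfolding I0_def I1_def I2_def by simp
    qed
    finally show ?thesis .
  qed
  then have "?T = (\<lambda>t. 2 * (I0 + (2 * t) * I1 + t\<^sup>2 * I2))" by (rule ext)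
  moreover have "((\<lambda>t. 2 * (I0 + (2 * t) * I1 + t\<^sup>2 * I2)) has_real_derivative 4 * I1) (at 0)"
    by (auto intro!: derivative_eq_intros)
  ultimately have "4 * I1 = 0" using T0 DERIV_unique by metis
  then show ?thesis by (simp add: I1_def)
qed

subsection \<open>The divergence theorem on the disc\<close>

lemma C_disc_lipschitz:
  fixes g :: "complex \<Rightarrow> 'a::real_normed_vector"
  assumes g: "C_disc (Suc k) g"
  obtains L where "L \<ge> 0" "\<And>x y. x \<in> disc \<Longrightarrow> y \<in> disc \<Longrightarrow> norm (g x - g y) \<le> L * norm (x - y)"
proof -
  have cont: "continuous_on disc (pd_u g)" "continuous_on disc (pd_v g)"
    using g by (auto intro: C_disc_imp_continuous_on simp only: C_disc.simps(2)[of k g])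
  have "bounded (pd_u g ` disc)" "bounded (pd_v g ` disc)"
    using cont by (auto intro!: compact_imp_bounded compact_continuous_image)
  then obtain A B where A: "A > 0" "\<And>w. w \<in> disc \<Longrightarrow> norm (pd_u g w) \<le> A"
    and B: "B > 0" "\<And>w. w \<in> disc \<Longrightarrow> norm (pd_v g w) \<le> B"
    unfolding bounded_pos by (metis imageI)
  have "norm (g x - g y) \<le> (A + B) * norm (x - y)" if "x \<in> disc" "y \<in> disc" for x y
  proof (rule differentiable_bound[OF convex_cball C_disc_has_derivative[OF g] onorm_le that])
    fix w h :: complex assume w: "w \<in> disc"
    have "norm (Re h *\<^sub>R pd_u g w + Im h *\<^sub>R pd_v g w) \<le> \<bar>Re h\<bar> * A + \<bar>Im h\<bar> * B"
      using A(2)[OF w] B(2)[OF w] by (intro order_trans[OF norm_triangle_ineq] add_mono) (auto intro: mult_left_mono)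
    also have "\<dots> \<le> (A + B) * norm h"
      unfolding distrib_right
      using A(1) B(1) by (simp add: add_mono mult.commute mult_left_mono abs_Re_le_cmod abs_Im_le_cmod)
    finally show "norm (Re h *\<^sub>R pd_u g w + Im h *\<^sub>R pd_v g w) \<le> (A + B) * norm h" .
  qed
  then show ?thesis using that[of "A + B"] A(1) B(1) by simp
qed

text \<open>A segment leaving the disc meets the circle, where g vanishes; comparing with that point
  keeps the same constant. This makes the difference quotients of the extension uniformly bounded,
  even across the circle.\<close>

lemma zero_extension_lipschitz:
  fixes g :: "complex \<Rightarrow> 'a::real_normed_vector"
  assumes L: "L \<ge> 0" "\<And>x y. x \<in> disc \<Longrightarrow> y \<in> disc \<Longrightarrow> norm (g x - g y) \<le> L * norm (x - y)"
    and 0: "\<And>w. norm w = 1 \<Longrightarrow> g w = 0"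
  defines "G \<equiv> \<lambda>w. indicator disc w *\<^sub>R g w"
  shows "norm (G x - G y) \<le> L * norm (x - y)"
proof -
  have mixed: "norm (g x) \<le> L * norm (x - y)" if "x \<in> disc" "y \<notin> disc" for x y
  proof -
    have "closed_segment x y \<inter> frontier disc \<noteq> {}"
      using that by (intro connected_Int_frontier) auto
    then obtain z where z: "z \<in> closed_segment x y" "norm z = 1" by (auto simp: frontier_cball)
    have "norm (x - z) \<le> norm (x - y)"
      using segment_bound(1)[OF z(1)] by (simp add: norm_minus_commute)
    then show ?thesis using L(2)[of x z] 0[of z] z(2) that L(1)
      by (simp add: order_trans[OF _ mult_left_mono])
  qed
  show ?thesis
    using L mixed[of x y] mixed[of y x]
    by (cases "x \<in> disc"; cases "y \<in> disc") (auto simp: G_def indicator_def norm_minus_commute)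
qed

text \<open>
  The integral of a difference quotient of the extension of g by zero vanishes by translation
  invariance; dominated convergence turns this into the vanishing of the integral of the
  directional derivative.
\<close>

lemma integral_directional_derivative_eq_0:
  fixes g :: "complex \<Rightarrow> real"
  assumes g: "C_disc (Suc k) g" and 0: "\<And>w. norm w = 1 \<Longrightarrow> g w = 0"
  shows "(LINT w:disc|lborel. Re e * pd_u g w + Im e * pd_v g w) = 0"
proof -
  define G where "G w = indicator disc w *\<^sub>R g w" for w
  obtain L where L: "L \<ge> 0" "\<And>x y. x \<in> disc \<Longrightarrow> y \<in> disc \<Longrightarrow> norm (g x - g y) \<le> L * norm (x - y)"
    using C_disc_lipschitz[OF g] by blast
  have lip: "norm (G x - G y) \<le> L * norm (x - y)" for x y
    unfolding G_def by (rule zero_extension_lipschitz[OF L 0])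
  have intG: "integrable lborel G"
    unfolding G_def by (rule borel_integrable_compact[OF compact_cball C_disc_imp_continuous_on[OF g]])
  have measG [measurable]: "G \<in> borel_measurable borel" using intG by auto
  define r where "r n = inverse (real (Suc n))" for n
  define q where "q n w = (G (w + r n *\<^sub>R e) - G w) /\<^sub>R r n" for n w
  have r: "r n > 0" "r n \<le> 1" for n by (auto simp: r_def field_simps)
  have r0: "r \<longlonglongrightarrow> 0" unfolding r_def by (rule LIMSEQ_inverse_real_of_nat)
  have trans: "integrable lborel (\<lambda>w. G (w + c))" "(LINT w|lborel. G (w + c)) = (LINT w|lborel. G w)" for c
  proof -
    have d: "distr lborel borel (\<lambda>w. w + c) = lborel"
      using lborel_distr_plus[of c] by (simp add: add.commute[of _ c] cong: distr_cong)
    have "integrable (distr lborel borel (\<lambda>w. w + c)) G" using intG by (simp only: d)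
    then show "integrable lborel (\<lambda>w. G (w + c))" by (subst (asm) integrable_distr_eq) auto
    have "(LINT w|lborel. G w) = (LINT w|distr lborel borel (\<lambda>w. w + c). G w)" by (simp only: d)
    also have "\<dots> = (LINT w|lborel. G (w + c))" by (subst integral_distr) auto
    finally show "(LINT w|lborel. G (w + c)) = (LINT w|lborel. G w)" by simp
  qed
  have q_int: "(LINT w|lborel. q n w) = 0" for n
    unfolding q_def using trans intG by simp
  let ?D = "\<lambda>w. indicator disc w *\<^sub>R (Re e * pd_u g w + Im e * pd_v g w)"
  have "(\<lambda>n. LINT w|lborel. q n w) \<longlonglongrightarrow> (LINT w|lborel. ?D w)"
  proof (rule integral_dominated_convergence)
    \<comment> \<open>Because \<open>r n \<le> 1\<close>, both points in \<open>q n w\<close> lie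
      off the disc once \<open>norm w > 1 + norm e\<close>; elsewhere the Lipschitz bound
      applies.\<close>
    show "integrable lborel (\<lambda>w. indicator (cball 0 (1 + norm e)) w *\<^sub>R (L * norm e))"
      by (intro borel_integrable_compact compact_cball continuous_intros)
    have "continuous_on disc (\<lambda>w. Re e * pd_u g w + Im e * pd_v g w)"
      using g by (auto intro!: continuous_intros intro: C_disc_imp_continuous_on simp only: C_disc.simps(2)[of k g])
    then show "?D \<in> borel_measurable lborel"
      using borel_integrable_compact[OF compact_cball] by blast
    show "q n \<in> borel_measurable lborel" for n
      unfolding q_def by measurable
    show "AE w in lborel. norm (q n w) \<le> indicator (cball 0 (1 + norm e)) w *\<^sub>R (L * norm e)" for n
    proof (rule AE_I2)
      fix w
      show "norm (q n w) \<le> indicator (cball 0 (1 + norm e)) w *\<^sub>R (L * norm e)"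
      proof (cases "norm w \<le> 1 + norm e")
        case True
        have "norm (q n w) = norm (G (w + r n *\<^sub>R e) - G w) / r n"
          using r(1)[of n] by (simp add: q_def divide_inverse abs_mult mult.commute)
        also have "\<dots> \<le> L * norm e"
          using lip[of "w + r n *\<^sub>R e" w] r(1)[of n] by (simp add: field_simps)
        finally show ?thesis using True by simp
      next
        case False
        have "norm w \<le> norm (w + r n *\<^sub>R e) + norm (r n *\<^sub>R e)" by (metis add_diff_cancel_right' norm_triangle_ineq4)
        moreover have "norm (r n *\<^sub>R e) \<le> norm e" using r[of n] by (simp add: mult_left_le_one_le)
        ultimately have "w \<notin> disc" "w + r n *\<^sub>R e \<notin> disc" using False norm_ge_zero[of e] unfolding mem_cball_0 by linarith+
        then show ?thesis using False by (simp add: q_def G_def)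
      qed
    qed
    \<comment> \<open>On the circle the zero extension may have a kink, so pointwise convergence is
      proved only off this null set.\<close>
    have "sphere (0::complex) 1 \<in> null_sets lborel"
      using negligible_sphere[of "0::complex" 1]
      by (auto simp: null_sets_completion_iff negligible_iff_null_sets)
    then have "AE w in lborel. w \<notin> sphere (0::complex) 1" by (rule AE_not_in)
    then show "AE w in lborel. (\<lambda>n. q n w) \<longlonglongrightarrow> ?D w"
    proof (rule AE_mp, intro AE_I2 impI)
      fix w :: complex assume "w \<notin> sphere 0 1"
      then consider "w \<in> ball 0 1" | "w \<in> - disc" by force
      then show "(\<lambda>n. q n w) \<longlonglongrightarrow> ?D w"
      proof cases
        case 1
        then have w: "w \<in> disc" by simp
        have "(g has_derivative (\<lambda>h. Re h *\<^sub>R pd_u g w + Im h *\<^sub>R pd_v g w)) (at w within ball 0 1)"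
          using has_derivative_subset[OF C_disc_has_derivative[OF g w] ball_subset_cball] .
        then have "(G has_derivative (\<lambda>h. Re h *\<^sub>R pd_u g w + Im h *\<^sub>R pd_v g w)) (at w within ball 0 1)"
          by (rule has_derivative_transform[OF 1, rotated]) (auto simp: G_def indicator_def)
        then have D: "(G has_derivative (\<lambda>h. Re h *\<^sub>R pd_u g w + Im h *\<^sub>R pd_v g w)) (at w)"
          using 1 at_within_open[OF 1 open_ball] by simp
        have "((\<lambda>t. G (w + t *\<^sub>R e)) has_derivative (\<lambda>t. Re (t *\<^sub>R e) *\<^sub>R pd_u g w + Im (t *\<^sub>R e) *\<^sub>R pd_v g w)) (at 0)"
          by (rule has_derivative_compose[of "\<lambda>t. w + t *\<^sub>R e" _ _ _ G, simplified])
             (use D in \<open>auto intro!: derivative_eq_intros\<close>)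
        then have "((\<lambda>t. G (w + t *\<^sub>R e)) has_real_derivative (Re e * pd_u g w + Im e * pd_v g w)) (at 0)"
          unfolding has_field_derivative_def by (rule has_derivative_eq_rhs) (simp add: fun_eq_iff algebra_simps)
        then have "((\<lambda>t. (G (w + t *\<^sub>R e) - G w) / t) \<longlongrightarrow> Re e * pd_u g w + Im e * pd_v g w) (at 0)"
          by (simp add: DERIV_def)
        moreover have "filterlim r (at 0) sequentially"
          using r0 r(1) by (auto simp: filterlim_at less_imp_neq[symmetric])
        ultimately have "(\<lambda>n. (G (w + r n *\<^sub>R e) - G w) / r n) \<longlonglongrightarrow> Re e * pd_u g w + Im e * pd_v g w"
          by (rule filterlim_compose)
        then show ?thesis using w by (simp add: q_def divide_inverse mult.commute)
      next
        case 2
        have "(\<lambda>n. w + r n *\<^sub>R e) \<longlonglongrightarrow> w + 0 *\<^sub>R e" by (intro tendsto_intros r0)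
        then have "\<forall>\<^sub>F n in sequentially. w + r n *\<^sub>R e \<in> - disc"
          using 2 by (intro topological_tendstoD) auto
        then have "\<forall>\<^sub>F n in sequentially. q n w = ?D w"
          by eventually_elim (use 2 in \<open>simp add: q_def G_def\<close>)
        then show ?thesis by (rule tendsto_eventually)
      qed
    qed
  qed
  then show ?thesis by (simp add: q_int LIMSEQ_const_iff set_lebesgue_integral_def)
qed

lemma integral_pd_eq_0:
  fixes g :: "complex \<Rightarrow> real"
  assumes "C_disc (Suc k) g" "\<And>w. norm w = 1 \<Longrightarrow> g w = 0"
  shows "(LINT w:disc|lborel. pd_u g w) = 0" "(LINT w:disc|lborel. pd_v g w) = 0"
  using integral_directional_derivative_eq_0[OF assms, of 1]
    integral_directional_derivative_eq_0[OF assms, of \<i>] by simp_all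

subsection \<open>The kernel and the mollifier\<close>

text \<open>A replacement for polar coordinates: f lies below a sum of constants on concentric discs
  of area pi r^2. With geometric radii it serves both for a singularity at w and for decay at
  infinity.\<close>

lemma nn_integral_le_suminf_cball:
  fixes f :: "complex \<Rightarrow> real"
  assumes "\<And>n. c n \<ge> 0" "\<And>n. r n \<ge> 0"
    and f: "\<And>z. f z \<le> 0 \<or> (\<exists>n. cmod (z - w) \<le> r n \<and> f z \<le> c n)"
    and sm: "summable (\<lambda>n. c n * (r n)\<^sup>2)"
  shows "(\<integral>\<^sup>+z. ennreal (f z) \<partial>lborel) \<le> ennreal (pi * (\<Sum>n. c n * (r n)\<^sup>2))"
proof -
  have "(\<integral>\<^sup>+z. ennreal (f z) \<partial>lborel) \<le> (\<integral>\<^sup>+z. (\<Sum>n. ennreal (c n) * indicator (cball w (r n)) z) \<partial>lborel)"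
  proof (rule nn_integral_mono)
    fix z
    from f[of z] show "ennreal (f z) \<le> (\<Sum>n. ennreal (c n) * indicator (cball w (r n)) z)"
    proof
      assume "\<exists>n. cmod (z - w) \<le> r n \<and> f z \<le> c n"
      then obtain n where n: "cmod (z - w) \<le> r n" "f z \<le> c n" by blast
      have "ennreal (f z) \<le> (\<Sum>n\<in>{n}. ennreal (c n) * indicator (cball w (r n)) z)"
        using n by (auto simp: dist_norm norm_minus_commute indicator_def ennreal_leI)
      also have "\<dots> \<le> (\<Sum>n. ennreal (c n) * indicator (cball w (r n)) z)"
        by (rule sum_le_suminf) auto
      finally show ?thesis .
    qed (simp add: ennreal_neg)
  qed
  also have "\<dots> = (\<Sum>n. \<integral>\<^sup>+z. ennreal (c n) * indicator (cball w (r n)) z \<partial>lborel)"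
    by (rule nn_integral_suminf)
      (intro borel_measurable_times_ennreal borel_measurable_const borel_measurable_indicator, simp)
  also have "\<dots> = (\<Sum>n. ennreal (pi * (c n * (r n)\<^sup>2)))"
    using assms(1,2)
    by (simp add: nn_integral_cmult_indicator emeasure_cball unit_ball_vol_2 mult_ac flip: ennreal_mult')
  also have "\<dots> = ennreal (pi * (\<Sum>n. c n * (r n)\<^sup>2))"
    using assms(1) sm by (subst suminf_ennreal2) (auto simp: suminf_mult intro!: summable_mult)
  finally show ?thesis .
qed

lemma disc_kernel_bound:
  assumes "0 < q" "q < 2"
  obtains C where "C \<ge> 0"
    "\<And>w. w \<in> disc \<Longrightarrow> set_integrable lborel disc (\<lambda>z. cmod (z - w) powr (-q))"
    "\<And>w. w \<in> disc \<Longrightarrow> (LINT z:disc|lborel. cmod (z - w) powr (-q)) \<le> C"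
proof -
  \<comment> \<open>On the dyadic ring \<open>(1/2)^n < cmod (z - w) \<le> 2 * (1/2)^n\<close> the
    kernel is at most \<open>c n\<close>, and the largest radius 2 is the diameter of the disc. The
    series has ratio \<open>2 powr q / 4\<close>, which is below 1 because q < 2. Since the rings
    are centred at w, the sum is the same for every w.\<close>
  define r c where "r n = 2 * (1/2::real) ^ n" and "c n = (2 powr q) ^ n" for n
  define C where "C = pi * (\<Sum>n. c n * (r n)\<^sup>2)"
  have cr: "c n * (r n)\<^sup>2 = 4 * (2 powr q / 4) ^ n" for n
    by (simp add: c_def r_def power_divide power_mult_distrib flip: power_mult)
       (simp add: mult.commute[of n 2] power_mult)
  have "2 powr q < 2 powr 2" using assms by (intro powr_less_mono) auto
  then have sm: "summable (\<lambda>n. c n * (r n)\<^sup>2)"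
    unfolding cr by (intro summable_mult summable_geometric) simp
  have c0: "c n \<ge> 0" and r0: "r n \<ge> 0" for n by (simp_all add: c_def r_def)
  have C0: "C \<ge> 0" unfolding C_def using sm c0 by (intro mult_nonneg_nonneg suminf_nonneg) auto
  have main: "(\<integral>\<^sup>+z. ennreal (indicator disc z *\<^sub>R cmod (z - w) powr (-q)) \<partial>lborel) \<le> ennreal C"
    if w: "w \<in> disc" for w
    unfolding C_def
  proof (rule nn_integral_le_suminf_cball[OF c0 r0 _ sm])
    fix z
    show "indicator disc z *\<^sub>R cmod (z - w) powr (-q) \<le> 0 \<or>
      (\<exists>n. cmod (z - w) \<le> r n \<and> indicator disc z *\<^sub>R cmod (z - w) powr (-q) \<le> c n)"
    \<comment> \<open>At \<open>z = w\<close> the kernel takes the default value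
      \<open>0 powr (-q) = 0\<close>, so the first alternative holds there.\<close>
    proof (cases "z \<in> disc \<and> z \<noteq> w")
      case True
      define d where "d = cmod (z - w)"
      have d: "d > 0" "d \<le> 2"
        using True w norm_triangle_ineq4[of z w] by (auto simp: d_def)
      obtain N where "(1/2) ^ N < d" using d(1) real_arch_pow_inv[of d "1/2"] by auto
      then obtain n where n: "(1/2) ^ n < d" "\<And>m. m < n \<Longrightarrow> \<not> (1/2) ^ m < d"
        using exists_least_iff[of "\<lambda>n. (1/2) ^ n < d"] by blast
      have "d \<le> r n" using d(2) n(2)[of "n - 1"] by (cases n) (auto simp: r_def)
      moreover have "d powr (-q) \<le> ((1/2) ^ n) powr (-q)"
        using n(1) assms by (intro powr_mono2') auto
      moreover have "((1/2::real) ^ n) powr (-q) = c n"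
      proof -
        have "((1/2::real) ^ n) powr (-q) = ((1/2) powr (real n)) powr (-q)" by (simp add: powr_realpow)
        also have "\<dots> = ((1/2) powr (-q)) powr (real n)" by (simp only: powr_powr mult.commute)
        also have "\<dots> = ((1/2) powr (-q)) ^ n" by (rule powr_realpow) simp
        also have "(1/2::real) powr (-q) = 2 powr q" by (simp add: powr_minus powr_divide)
        finally show ?thesis by (simp add: c_def)
      qed
      ultimately show ?thesis using True by (auto simp: d_def intro!: exI[of _ n])
    qed (auto simp: indicator_def)
  qed
  have [measurable]: "disc \<in> sets borel" by simp
  have meas: "(\<lambda>z. indicator disc z *\<^sub>R cmod (z - w) powr (-q)) \<in> borel_measurable lborel" for w
    by measurable
  have int: "set_integrable lborel disc (\<lambda>z. cmod (z - w) powr (-q))" if "w \<in> disc" for w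
    unfolding set_integrable_def
    by (rule integrableI_nonneg[OF meas]) (use le_less_trans[OF main[OF that]] in auto)
  have "(LINT z:disc|lborel. cmod (z - w) powr (-q)) \<le> C" if "w \<in> disc" for w
    unfolding set_lebesgue_integral_def by (rule integral_real_bounded[OF C0 main[OF that]])
  then show ?thesis using that[OF C0 int] by blast
qed

text \<open>The dbar-derivative of \<open>cauchy_reg e\<close> is the rescaling
  \<open>mollifier (z / e) / e^2\<close> of this profile. It is left unnormalised; its integral is
  carried along and divided out at the end.\<close>

definition mollifier :: "complex \<Rightarrow> real" where
  "mollifier z = 1 / (1 + (cmod z)\<^sup>2)\<^sup>2"

lemma mollifier_pos: "mollifier z > 0"
  unfolding mollifier_def by (intro divide_pos_pos zero_less_power add_pos_nonneg) auto

lemma continuous_on_mollifier: "continuous_on S mollifier"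
  unfolding mollifier_def by (intro continuous_intros) (auto simp: add_nonneg_eq_0_iff)

lemma integrable_mollifier: "integrable lborel mollifier"
proof -
  \<comment> \<open>For \<open>n > 0\<close> and \<open>2^(n-1) \<le> cmod z < 2^n\<close> the
    profile is at most \<open>cmod z\<close> to the power -4, hence at most
    \<open>16 * (1/16)^n\<close>; for \<open>n = 0\<close> it is at most 1.\<close>
  define r c where "r n = (2::real) ^ n" and "c n = 16 * (1/16::real) ^ n" for n
  have cr: "c n * (r n)\<^sup>2 = 16 * (1/4) ^ n" for n
  proof -
    have "(r n)\<^sup>2 = 4 ^ n" by (simp add: r_def flip: power_mult) (simp add: mult.commute[of n 2] power_mult)
    then show ?thesis by (simp add: c_def flip: power_mult_distrib)
  qed
  have sm: "summable (\<lambda>n. c n * (r n)\<^sup>2)"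
    unfolding cr by (intro summable_mult summable_geometric) simp
  have "(\<integral>\<^sup>+z. ennreal (mollifier z) \<partial>lborel) \<le> ennreal (pi * (\<Sum>n. c n * (r n)\<^sup>2))"
  proof (rule nn_integral_le_suminf_cball[OF _ _ _ sm, where w = 0])
    fix z
    obtain N where "cmod z < 2 ^ N" using real_arch_pow[of 2 "cmod z"] by auto
    then obtain n where n: "cmod z < 2 ^ n" "\<And>m. m < n \<Longrightarrow> \<not> cmod z < 2 ^ m"
      using exists_least_iff[of "\<lambda>n. cmod z < 2 ^ n"] by blast
    have "mollifier z \<le> c n"
    proof (cases n)
      case 0
      have "1 \<le> (1 + (cmod z)\<^sup>2)\<^sup>2" by (intro one_le_power) simp
      then have "mollifier z \<le> 1" unfolding mollifier_def by (simp only: divide_le_eq) auto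
      then show ?thesis by (simp add: 0 c_def)
    next
      case (Suc m)
      have "2 ^ m \<le> cmod z" using n(2)[of m] Suc by simp
      then have "(2 ^ m)\<^sup>2 \<le> (cmod z)\<^sup>2" by (intro power_mono) auto
      then have "((2 ^ m)\<^sup>2)\<^sup>2 \<le> (1 + (cmod z)\<^sup>2)\<^sup>2" by (intro power_mono) (linarith, simp)
      moreover have "((2 ^ m)\<^sup>2)\<^sup>2 = (16::real) ^ m"
        by (simp flip: power_mult) (simp add: mult.commute[of m 4] power_mult)
      ultimately have "mollifier z \<le> 1 / 16 ^ m"
        unfolding mollifier_def by (intro divide_left_mono) (auto intro!: mult_pos_pos zero_less_power add_pos_nonneg)
      then show ?thesis by (simp add: c_def Suc power_one_over)
    qed
    then show "mollifier z \<le> 0 \<or> (\<exists>n. cmod (z - 0) \<le> r n \<and> mollifier z \<le> c n)"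
      using n(1) by (auto simp: r_def intro!: exI[of _ n])
  qed (auto simp: c_def r_def)
  then show ?thesis
    by (intro integrableI_nonneg borel_measurable_continuous_onI[of mollifier, simplified] continuous_on_mollifier)
       (auto simp: mollifier_pos less_imp_le intro: le_less_trans
         borel_measurable_continuous_onI continuous_on_mollifier)
qed

lemma integral_mollifier_pos: "(LINT z|lborel. mollifier z) > 0"
proof -
  have "(LINT z|lborel. mollifier z) \<noteq> 0"
  proof
    assume "(LINT z|lborel. mollifier z) = 0"
    then have "AE z in lborel. mollifier z = 0"
      using integral_nonneg_eq_0_iff_AE[OF integrable_mollifier] mollifier_pos less_imp_le by blast
    then have "AE z::complex in lborel. False" by eventually_elim (metis mollifier_pos less_irrefl)
    then show False by (simp add: eventually_False ae_filter_eq_bot_iff)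
  qed
  moreover have "(LINT z|lborel. mollifier z) \<ge> 0"
    by (intro Bochner_Integration.integral_nonneg) (simp add: mollifier_pos less_imp_le)
  ultimately show ?thesis by simp
qed

lemma lborel_integral_affine_complex:
  fixes h :: "complex \<Rightarrow> real"
  assumes [measurable]: "h \<in> borel_measurable borel" and "c > 0"
  shows "(LINT z|lborel. h z) = c\<^sup>2 * (LINT z|lborel. h (w + c *\<^sub>R z))"
  using assms(2)
  by (subst lborel_affine[of c w]) (simp_all add: integral_density integral_distr)

text \<open>Substituting \<open>w + \<epsilon> n *\<^sub>R z\<close> moves the parameter from the
  kernel into f, so that a constant times \<open>mollifier\<close> dominates. As w is interior, the
  extension of f by zero is continuous at w.\<close>

lemma mollifier_approximate_identity:
  fixes f :: "complex \<Rightarrow> real"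
  assumes f: "continuous_on disc f" and w: "w \<in> ball 0 1"
    and e: "\<And>n. \<epsilon> n > 0" "\<epsilon> \<longlonglongrightarrow> 0"
  shows "(\<lambda>n. LINT z:disc|lborel. f z * ((\<epsilon> n)\<^sup>2 / ((cmod (z - w))\<^sup>2 + (\<epsilon> n)\<^sup>2)\<^sup>2))
    \<longlonglongrightarrow> f w * (LINT z|lborel. mollifier z)"
proof -
  define G where "G z = indicator disc z *\<^sub>R f z" for z
  have G_meas [measurable]: "G \<in> borel_measurable borel"
    unfolding G_def using borel_measurable_continuous_on_indicator[OF _ f] by simp
  have mol_meas [measurable]: "mollifier \<in> borel_measurable borel"
    by (rule borel_measurable_continuous_onI[OF continuous_on_mollifier])
  have "bounded (f ` disc)" using f by (auto intro!: compact_imp_bounded compact_continuous_image)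
  then obtain M where M: "M > 0" "\<And>z. z \<in> disc \<Longrightarrow> norm (f z) \<le> M"
    unfolding bounded_pos by (metis imageI)
  have G_le: "norm (G z) \<le> M" for z using M by (auto simp: G_def indicator_def)
  have eq: "(LINT z:disc|lborel. f z * ((\<epsilon> n)\<^sup>2 / ((cmod (z - w))\<^sup>2 + (\<epsilon> n)\<^sup>2)\<^sup>2))
      = (LINT z|lborel. G (w + \<epsilon> n *\<^sub>R z) * mollifier z)" for n
  proof -
    define e where "e = \<epsilon> n"
    have e: "e > 0" using assms(3) by (simp add: e_def)
    have sc: "e\<^sup>2 * (e\<^sup>2 / ((cmod (e *\<^sub>R z))\<^sup>2 + e\<^sup>2)\<^sup>2) = mollifier z" for z :: complex
    proof -
      have "(cmod (e *\<^sub>R z))\<^sup>2 + e\<^sup>2 = e\<^sup>2 * (1 + (cmod z)\<^sup>2)"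
        by (simp add: power_mult_distrib algebra_simps)
      then show ?thesis using e by (simp add: mollifier_def power_mult_distrib power2_eq_square)
    qed
    have "(LINT z:disc|lborel. f z * (e\<^sup>2 / ((cmod (z - w))\<^sup>2 + e\<^sup>2)\<^sup>2))
        = (LINT z|lborel. G z * (e\<^sup>2 / ((cmod (z - w))\<^sup>2 + e\<^sup>2)\<^sup>2))"
      by (simp add: set_lebesgue_integral_def G_def mult.assoc)
    also have "\<dots> = e\<^sup>2 * (LINT z|lborel. G (w + e *\<^sub>R z) * (e\<^sup>2 / ((cmod (w + e *\<^sub>R z - w))\<^sup>2 + e\<^sup>2)\<^sup>2))"
      using e by (intro lborel_integral_affine_complex) auto
    also have "\<dots> = (LINT z|lborel. G (w + e *\<^sub>R z) * (e\<^sup>2 * (e\<^sup>2 / ((cmod (e *\<^sub>R z))\<^sup>2 + e\<^sup>2)\<^sup>2)))"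
      by (simp add: mult_ac flip: integral_mult_right_zero)
    finally show ?thesis unfolding sc unfolding e_def .
  qed
  have "(\<lambda>n. LINT z|lborel. G (w + \<epsilon> n *\<^sub>R z) * mollifier z) \<longlonglongrightarrow> (LINT z|lborel. f w * mollifier z)"
  proof (rule integral_dominated_convergence)
    show "integrable lborel (\<lambda>z. M * mollifier z)"
      using integrable_mollifier by simp
    show "(\<lambda>z. f w * mollifier z) \<in> borel_measurable lborel"
      "(\<lambda>z. G (w + \<epsilon> n *\<^sub>R z) * mollifier z) \<in> borel_measurable lborel" for n
      by measurable
    show "AE z in lborel. norm (G (w + \<epsilon> n *\<^sub>R z) * mollifier z) \<le> M * mollifier z" for n
    proof (rule AE_I2)
      fix z show "norm (G (w + \<epsilon> n *\<^sub>R z) * mollifier z) \<le> M * mollifier z"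
        using G_le[of "w + \<epsilon> n *\<^sub>R z"] mollifier_pos[of z] by (simp add: abs_mult mult_right_mono)
    qed
    show "AE z in lborel. (\<lambda>n. G (w + \<epsilon> n *\<^sub>R z) * mollifier z) \<longlonglongrightarrow> f w * mollifier z"
    proof (rule AE_I2)
      fix z
      have "continuous_on (ball 0 1) G"
        using continuous_on_subset[OF f ball_subset_cball]
        by (rule continuous_on_eq) (auto simp: G_def indicator_def)
      then have "isCont G w" using w by (simp add: continuous_on_eq_continuous_at)
      moreover have "(\<lambda>n. w + \<epsilon> n *\<^sub>R z) \<longlonglongrightarrow> w + 0 *\<^sub>R z" by (intro tendsto_intros e)
      then have "(\<lambda>n. w + \<epsilon> n *\<^sub>R z) \<longlonglongrightarrow> w" by simp
      ultimately have "(\<lambda>n. G (w + \<epsilon> n *\<^sub>R z)) \<longlonglongrightarrow> G w" by (rule isCont_tendsto_compose)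
      moreover have "G w = f w" using w by (simp add: G_def)
      ultimately show "(\<lambda>n. G (w + \<epsilon> n *\<^sub>R z) * mollifier z) \<longlonglongrightarrow> f w * mollifier z"
        by (intro tendsto_intros) simp
    qed
  qed
  then show ?thesis unfolding eq by simp
qed

subsection \<open>The test functions\<close>

text \<open>The two components of F play different roles: \<open>Re F\<close> serves as an angle of
  rotation and may be arbitrary on the circle, while \<open>Im F\<close> is integrated by parts and
  must vanish there.\<close>

lemma weak_dbar_identity:
  fixes F :: "complex \<Rightarrow> complex"
  assumes crit: "critical_normal_section X N1 N2" and F: "C_disc 3 F"
    and bd: "\<And>w. norm w = 1 \<Longrightarrow> Im (F w) = 0"
  shows "(LINT w:disc|lborel. Re (complex_torsion N1 N2 w * (pd_u F w + \<i> * pd_v F w)))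
    = (LINT w:disc|lborel. normal_curvature N1 N2 w * Im (F w))"
proof -
  let ?a = "torsion_u N1 N2" and ?b = "torsion_v N1 N2"
  have N: "orthonormal_normal_section X N1 N2"
    using crit by (simp add: critical_normal_section_def)
  have F3: "C_disc (Suc 2) F" and F1: "C_disc (Suc 0) F"
    using F C_disc_mono[OF F, of 1] by (simp_all add: eval_nat_numeral)
  have a1: "C_disc (Suc 0) ?a" and b1: "C_disc (Suc 0) ?b"
    using C_disc_mono[OF C_disc_torsion(1)[OF N], of 1] C_disc_mono[OF C_disc_torsion(2)[OF N], of 1]
    by simp_all
  note Re3 = C_disc_bounded_linear[OF bounded_linear_Re F]
  note Im1 = C_disc_bounded_linear[OF bounded_linear_Im F1]
  note pdF = pd_bounded_linear[OF bounded_linear_Re F1] pd_bounded_linear[OF bounded_linear_Im F1]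
  have cont: "continuous_on disc ?a" "continuous_on disc ?b"
    "continuous_on disc (pd_u ?a)" "continuous_on disc (pd_v ?a)"
    "continuous_on disc (pd_u ?b)" "continuous_on disc (pd_v ?b)"
    "continuous_on disc F" "continuous_on disc (pd_u F)" "continuous_on disc (pd_v F)"
    using a1 b1 F1 C_disc_imp_continuous_on[OF a1] C_disc_imp_continuous_on[OF b1]
      C_disc_imp_continuous_on[OF F1] by simp_all
  have div: "(LINT w:disc|lborel. ?a w * Re (pd_u F w) + ?b w * Re (pd_v F w)) = 0"
  proof -
    have "(LINT w:disc|lborel. ?a w * Re (pd_u F w) + ?b w * Re (pd_v F w)) =
      (LINT w:disc|lborel. ?a w * pd_u (\<lambda>w. Re (F w)) w + ?b w * pd_v (\<lambda>w. Re (F w)) w)"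
      by (rule set_lebesgue_integral_cong) (auto simp: pdF)
    also have "\<dots> = 0" by (rule critical_imp_weakly_divergence_free[OF crit Re3])
    finally show ?thesis .
  qed
  have green_a: "(LINT w:disc|lborel. ?a w * Im (pd_v F w) + pd_v ?a w * Im (F w)) = 0"
  proof -
    have "(LINT w:disc|lborel. ?a w * Im (pd_v F w) + pd_v ?a w * Im (F w)) =
      (LINT w:disc|lborel. pd_v (\<lambda>w. ?a w * Im (F w)) w)"
      by (rule set_lebesgue_integral_cong) (auto simp: pd_mult[OF a1 Im1] pdF)
    also have "\<dots> = 0" by (rule integral_pd_eq_0(2)[OF C_disc_mult[OF a1 Im1]]) (simp add: bd)
    finally show ?thesis .
  qed
  have green_b: "(LINT w:disc|lborel. ?b w * Im (pd_u F w) + pd_u ?b w * Im (F w)) = 0"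
  proof -
    have "(LINT w:disc|lborel. ?b w * Im (pd_u F w) + pd_u ?b w * Im (F w)) =
      (LINT w:disc|lborel. pd_u (\<lambda>w. ?b w * Im (F w)) w)"
      by (rule set_lebesgue_integral_cong) (auto simp: pd_mult[OF b1 Im1] pdF)
    also have "\<dots> = 0" by (rule integral_pd_eq_0(1)[OF C_disc_mult[OF b1 Im1]]) (simp add: bd)
    finally show ?thesis .
  qed
  have int: "set_integrable lborel disc (\<lambda>w. ?a w * Re (pd_u F w) + ?b w * Re (pd_v F w))"
    "set_integrable lborel disc (\<lambda>w. ?a w * Im (pd_v F w) + pd_v ?a w * Im (F w))"
    "set_integrable lborel disc (\<lambda>w. ?b w * Im (pd_u F w) + pd_u ?b w * Im (F w))"
    "set_integrable lborel disc (\<lambda>w. normal_curvature N1 N2 w * Im (F w))"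
    unfolding normal_curvature_def by (intro set_integrable_disc continuous_intros cont)+
  \<comment> \<open>The first three groups integrate to zero by \<open>div\<close>,
    \<open>green_a\<close> and \<open>green_b\<close>; the derivatives of a and b introduced to
    complete the product rules are what the curvature term compensates.\<close>
  have "(LINT w:disc|lborel. Re (complex_torsion N1 N2 w * (pd_u F w + \<i> * pd_v F w)))
    = (LINT w:disc|lborel. (?a w * Re (pd_u F w) + ?b w * Re (pd_v F w))
        - (?a w * Im (pd_v F w) + pd_v ?a w * Im (F w))
        + (?b w * Im (pd_u F w) + pd_u ?b w * Im (F w))
        + normal_curvature N1 N2 w * Im (F w))"
    by (rule set_lebesgue_integral_cong)
      (auto simp: complex_torsion_def normal_curvature_def algebra_simps)
  also have "\<dots> = (LINT w:disc|lborel. normal_curvature N1 N2 w * Im (F w))"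
    using int by (simp add: div green_a green_b)
  finally show ?thesis .
qed

text \<open>
  The kernel of the test function: a regularisation of 1 / z, whose dbar-derivative is the mollifier
  of width e.
\<close>

definition cauchy_reg :: "real \<Rightarrow> complex \<Rightarrow> complex" where
  "cauchy_reg e z = cnj z * inverse (z * cnj z + of_real (e\<^sup>2))"

lemma cauchy_reg_denominator:
  "z * cnj z + of_real (e\<^sup>2) = of_real ((cmod z)\<^sup>2 + e\<^sup>2)"
  by (simp only: of_real_add complex_norm_square)

lemma cauchy_reg_denominator_nonzero:
  "e > 0 \<Longrightarrow> z * cnj z + of_real (e\<^sup>2) \<noteq> 0"
  unfolding cauchy_reg_denominator of_real_eq_0_iff by (simp add: add_nonneg_eq_0_iff)

lemma norm_cauchy_reg_le: "e > 0 \<Longrightarrow> norm (cauchy_reg e z) \<le> inverse (norm z)"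
proof (cases "z = 0")
  case False
  assume "e > 0"
  have "norm (cauchy_reg e z) = norm z / ((norm z)\<^sup>2 + e\<^sup>2)"
    unfolding cauchy_reg_def cauchy_reg_denominator norm_mult norm_inverse norm_of_real
    by (simp add: divide_inverse)
  also have "\<dots> \<le> norm z / (norm z)\<^sup>2"
    using False by (intro divide_left_mono) (auto intro!: mult_pos_pos add_pos_nonneg)
  finally show ?thesis using False by (simp add: power2_eq_square divide_simps)
qed (simp add: cauchy_reg_def)

lemma C_disc_cnj: "C_disc k f \<Longrightarrow> C_disc k (\<lambda>w. cnj (f w))"
  by (rule C_disc_bounded_linear[OF bounded_linear_cnj])

text \<open>With the squared modulus written as \<open>z * cnj z\<close>, the kernel is built from
  products, one conjugation and one inverse, so smoothness of every order follows from the closure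
  rules.\<close>

lemma C_disc_cauchy_reg:
  assumes "e > 0" "C_disc k f"
  shows "C_disc k (\<lambda>w. cauchy_reg e (f w))"
  unfolding cauchy_reg_def
  by (rule C_disc_mult[OF C_disc_cnj C_disc_inverse[OF C_disc_add[OF C_disc_mult C_disc_const]]])
    (rule assms C_disc_cnj cauchy_reg_denominator_nonzero)+

text \<open>The left side is twice the derivative with respect to conj(w). The inner map is
  holomorphic, so the chain rule contributes only \<open>cnj \<beta>\<close>. The spellings
  \<open>- w + 1 * z\<close> and \<open>1 + (- cnj w) * z\<close> in \<open>test_fun\<close> are
  chosen to match this affine shape.\<close>

lemma dbar_cauchy_reg_affine:
  fixes \<alpha> \<beta> :: complex
  assumes e: "e > 0" and w: "w \<in> disc"
  defines "f \<equiv> \<lambda>w. \<alpha> + \<beta> * w"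
  shows "pd_u (\<lambda>w. cauchy_reg e (f w)) w + \<i> * pd_v (\<lambda>w. cauchy_reg e (f w)) w
    = 2 * cnj \<beta> * of_real (e\<^sup>2 / ((cmod (f w))\<^sup>2 + e\<^sup>2)\<^sup>2)"
proof -
  define A where "A = f w * cnj (f w) + of_real (e\<^sup>2)"
  have A0: "A \<noteq> 0" unfolding A_def by (rule cauchy_reg_denominator_nonzero[OF e])
  have "((\<lambda>w. cauchy_reg e (f w)) has_derivative
    (\<lambda>h. cnj (f w) * (- (inverse A * (f w * cnj (\<beta> * h) + \<beta> * h * cnj (f w)) * inverse A))
      + cnj (\<beta> * h) * inverse A)) (at w within disc)"
    unfolding cauchy_reg_def A_def f_def
    by (rule derivative_eq_intros refl
        cauchy_reg_denominator_nonzero[OF e] bounded_linear.has_derivative[OF bounded_linear_cnj])+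
      simp
  note pd = pd_eqI[OF this w]
  have "pd_u (\<lambda>w. cauchy_reg e (f w)) w + \<i> * pd_v (\<lambda>w. cauchy_reg e (f w)) w
      = 2 * cnj \<beta> * (A - f w * cnj (f w)) * inverse A * inverse A"
    unfolding pd using A0 by (simp add: field_simps)
  also have "\<dots> = 2 * cnj \<beta> * of_real (e\<^sup>2 / ((cmod (f w))\<^sup>2 + e\<^sup>2)\<^sup>2)"
    using A0 cauchy_reg_denominator[of "f w" e]
    by (simp add: A_def power2_eq_square divide_inverse mult_ac)
  finally show ?thesis .
qed

text \<open>
  The second summand is the reflection of the first one in the unit circle: on the circle they are
  complex conjugates of each other, so that the test function is real there.
\<close>

definition test_fun :: "complex \<Rightarrow> complex \<Rightarrow> real \<Rightarrow> complex \<Rightarrow> complex" where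
  "test_fun l w e z =
     l * cauchy_reg e (- w + 1 * z) + cnj l * (z * cauchy_reg e (1 + (- cnj w) * z))"

lemma C_disc_test_fun:
  assumes "e > 0"
  shows "C_disc k (test_fun l w e)"
  unfolding test_fun_def[abs_def]
  by (intro C_disc_add C_disc_mult C_disc_cauchy_reg assms C_disc_const C_disc_ident)

text \<open>On the circle \<open>z * cnj z = 1\<close>, hence
  \<open>z * cnj (1 - cnj w * z) = z - w\<close>. The two arguments thus have equal modulus, so even
  the regularised denominators agree, and the factor z in the second summand turns its numerator
  into the conjugate of the first one.\<close>

lemma Im_test_fun_circle:
  assumes "norm z = 1"
  shows "Im (test_fun l w e z) = 0"
proof -
  have zz: "z * cnj z = 1" using assms by (metis complex_norm_square of_real_1 power_one)
  let ?x = "1 + (- cnj w) * z"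
  have x: "z * cnj ?x = - w + 1 * z"
    using zz by (simp add: algebra_simps)
  have "norm ?x = norm (- w + 1 * z)"
    unfolding x[symmetric] norm_mult using assms by (metis complex_mod_cnj mult_1)
  then have "z * cauchy_reg e ?x = cnj (cauchy_reg e (- w + 1 * z))"
    unfolding cauchy_reg_def cauchy_reg_denominator
    by (simp only: x[symmetric] mult.assoc[symmetric]) (simp add: mult.commute)
  then have "cnj l * (z * cauchy_reg e ?x) = cnj (l * cauchy_reg e (- w + 1 * z))" by simp
  then show ?thesis unfolding test_fun_def by (simp only: complex_add_cnj Im_complex_of_real)
qed

text \<open>This bounds the reflected summand by the kernel with pole w, uniformly up to the
  circle.\<close>

lemma norm_reflection_ge:
  assumes "z \<in> disc" "w \<in> disc"
  shows "norm (z - w) \<le> norm (1 + (- cnj w) * z)"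
proof -
  have "(norm z)\<^sup>2 \<le> 1" "(norm w)\<^sup>2 \<le> 1" using assms by (simp_all add: power_le_one)
  then have "0 \<le> (1 - (norm z)\<^sup>2) * (1 - (norm w)\<^sup>2)" by simp
  moreover have "(norm (1 + (- cnj w) * z))\<^sup>2 - (norm (z - w))\<^sup>2 = (1 - (norm z)\<^sup>2) * (1 - (norm w)\<^sup>2)"
    unfolding cmod_power2 by (simp add: power2_eq_square algebra_simps)
  ultimately have "(norm (z - w))\<^sup>2 \<le> (norm (1 + (- cnj w) * z))\<^sup>2" by linarith
  then show ?thesis by (rule power2_le_imp_le) simp
qed

lemma norm_test_fun_le:
  assumes "e > 0" "z \<in> disc" "w \<in> disc" "z \<noteq> w"
  shows "norm (test_fun l w e z) \<le> 2 * norm l * cmod (z - w) powr (-1)"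
proof -
  let ?x = "1 + (- cnj w) * z"
  have pos: "norm (z - w) > 0" using assms by simp
  have "norm (cauchy_reg e ?x) \<le> inverse (norm (z - w))"
    using norm_cauchy_reg_le[OF assms(1), of ?x] le_imp_inverse_le[OF norm_reflection_ge[OF assms(2,3)] pos]
    by linarith
  then have "norm (z * cauchy_reg e ?x) \<le> 1 * inverse (norm (z - w))"
    unfolding norm_mult using assms(2) by (intro mult_mono) auto
  moreover have "norm (cauchy_reg e (- w + 1 * z)) \<le> inverse (norm (z - w))"
    using norm_cauchy_reg_le[OF assms(1), of "z - w"] by simp
  ultimately have "norm l * norm (cauchy_reg e (- w + 1 * z)) + norm l * norm (z * cauchy_reg e ?x)
    \<le> norm l * inverse (norm (z - w)) + norm l * inverse (norm (z - w))"
    by (intro add_mono mult_left_mono) auto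
  then have "norm (test_fun l w e z) \<le> 2 * norm l * inverse (norm (z - w))"
    unfolding test_fun_def
    using norm_triangle_ineq[of "l * cauchy_reg e (- w + 1 * z)" "cnj l * (z * cauchy_reg e ?x)"]
    by (simp add: norm_mult)
  then show ?thesis using pos by (simp add: powr_minus)
qed

text \<open>The factor z of the reflected summand is holomorphic: differentiating it gives
  \<open>?g z + \<i> * \<i> * ?g z = 0\<close>, and only the kernels contribute.\<close>

lemma dbar_test_fun:
  assumes e: "e > 0" and z: "z \<in> disc"
  shows "pd_u (test_fun l w e) z + \<i> * pd_v (test_fun l w e) z =
    2 * l * of_real (e\<^sup>2 / ((cmod (z - w))\<^sup>2 + e\<^sup>2)\<^sup>2)
    - 2 * cnj l * w * z * of_real (e\<^sup>2 / ((cmod (1 - cnj w * z))\<^sup>2 + e\<^sup>2)\<^sup>2)"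
proof -
  let ?f = "\<lambda>z. cauchy_reg e (- w + 1 * z)" and ?g = "\<lambda>z. cauchy_reg e (1 + (- cnj w) * z)"
  have id: "C_disc (Suc 0) (\<lambda>z::complex. z)" by (rule C_disc_ident)
  have f: "C_disc (Suc 0) ?f" and g: "C_disc (Suc 0) ?g"
    by (intro C_disc_cauchy_reg[OF e] C_disc_add C_disc_mult C_disc_const C_disc_ident)+
  note zg = C_disc_mult[OF id g]
  have c: "C_disc (Suc 0) (\<lambda>_. c)" for c :: complex by (rule C_disc_const)
  have pd_const: "pd_u (\<lambda>_. c) z = 0" "pd_v (\<lambda>_. c) z = 0" for c :: complex
    using pd_eqI[OF has_derivative_const z] by auto
  have pd_id: "pd_u (\<lambda>z. z) z = 1" "pd_v (\<lambda>z. z) z = \<i>"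
    using pd_eqI[OF has_derivative_ident z] by auto
  have pd: "pd_u (test_fun l w e) z = l * pd_u ?f z + cnj l * (z * pd_u ?g z + ?g z)"
    "pd_v (test_fun l w e) z = l * pd_v ?f z + cnj l * (z * pd_v ?g z + \<i> * ?g z)"
    unfolding test_fun_def[abs_def]
      pd_add[OF C_disc_mult[OF c f] C_disc_mult[OF c zg] z] pd_mult[OF c f z] pd_mult[OF c zg z]
      pd_mult[OF id g z] pd_const pd_id by simp_all
  have "pd_u (test_fun l w e) z + \<i> * pd_v (test_fun l w e) z =
    l * (pd_u ?f z + \<i> * pd_v ?f z) + cnj l * z * (pd_u ?g z + \<i> * pd_v ?g z)"
    unfolding pd by (simp add: algebra_simps)
  also have "\<dots> = 2 * l * of_real (e\<^sup>2 / ((cmod (z - w))\<^sup>2 + e\<^sup>2)\<^sup>2)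
    - 2 * cnj l * w * z * of_real (e\<^sup>2 / ((cmod (1 - cnj w * z))\<^sup>2 + e\<^sup>2)\<^sup>2)"
    unfolding dbar_cauchy_reg_affine[OF e z] by (simp add: algebra_simps)
  finally show ?thesis .
qed

subsection \<open>The estimate\<close>

text \<open>Young's inequality without the weights: according to whether
  \<open>y \<le> x powr (r - 1)\<close>, one summand alone already bounds the product. The loss
  affects only constants.\<close>

lemma mult_le_powr_add_powr:
  fixes x y r :: real
  assumes "x \<ge> 0" "y \<ge> 0" "r > 1"
  shows "x * y \<le> x powr r + y powr (r / (r - 1))"
proof (cases "x = 0 \<or> y = 0")
  case False
  then have x: "x > 0" and y: "y > 0" using assms by auto
  show ?thesis
  proof (cases "y \<le> x powr (r - 1)")
    case True
    then have "x * y \<le> x * x powr (r - 1)" using x by simp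
    also have "\<dots> = x powr 1 * x powr (r - 1)" using x by simp
    also have "\<dots> = x powr r" by (subst powr_add[symmetric]) simp
    finally show ?thesis by (simp add: add_increasing2)
  next
    case False
    have "x = (x powr (r - 1)) powr (1 / (r - 1))" using x assms by (simp add: powr_powr)
    also have "\<dots> \<le> y powr (1 / (r - 1))" using False assms by (intro powr_mono2) auto
    finally have "x * y \<le> y powr (1 / (r - 1)) * y powr 1" using y by simp
    also have "\<dots> = y powr (1 / (r - 1) + 1)" by (rule powr_add[symmetric])
    also have "1 / (r - 1) + 1 = r / (r - 1)" using assms by (simp add: field_simps)
    finally show ?thesis by (simp add: add_increasing)
  qed
qed auto

lemma set_integrable_continuous_mult:
  fixes f g :: "complex \<Rightarrow> real"
  assumes f: "continuous_on disc f" and g: "set_integrable lborel disc g"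
  shows "set_integrable lborel disc (\<lambda>z. f z * g z)"
proof -
  have "bounded (f ` disc)" using f by (auto intro!: compact_imp_bounded compact_continuous_image)
  then obtain M where M: "\<And>z. z \<in> disc \<Longrightarrow> \<bar>f z\<bar> \<le> M"
    unfolding bounded_pos by (metis imageI real_norm_def)
  have eq: "indicator disc z *\<^sub>R (f z * g z) = (indicator disc z *\<^sub>R f z) * (indicator disc z *\<^sub>R g z)" for z
    by (simp add: indicator_def)
  show ?thesis
    unfolding set_integrable_def
  proof (rule Bochner_Integration.integrable_bound)
    show "integrable lborel (\<lambda>z. M * (indicator disc z *\<^sub>R g z))"
      using g unfolding set_integrable_def by simp
    show "(\<lambda>z. indicator disc z *\<^sub>R (f z * g z)) \<in> borel_measurable lborel"
      using set_integrable_disc[OF f] g unfolding set_integrable_def eq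
      by (intro borel_measurable_times) auto
    show "AE z in lborel. norm (indicator disc z *\<^sub>R (f z * g z)) \<le> norm (M * (indicator disc z *\<^sub>R g z))"
      using M by (intro AE_I2) (fastforce simp: indicator_def abs_mult intro!: mult_right_mono)
  qed
qed

text \<open>Hoelder's inequality by scaling: for \<open>\<sigma>\<close> above the norm, the Young
  estimate for \<open>\<bar>f z\<bar> / \<sigma>\<close> and the kernel integrates to at most
  \<open>1 + C\<close>; then \<open>\<sigma>\<close> decreases to the norm. The strict inequality
  keeps \<open>\<sigma>\<close> positive even if the norm is zero.\<close>

lemma integral_kernel_le_Lp_norm_finite:
  fixes r :: real
  assumes r: "2 < r"
  obtains C where "C > 0" "\<And>f w. continuous_on disc f \<Longrightarrow> w \<in> disc \<Longrightarrow>
    (LINT z:disc|lborel. \<bar>f z\<bar> * cmod (z - w) powr (-1)) \<le> C * Lp_norm_disc (ereal r) f"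
proof -
  define q where "q = r / (r - 1)"
  have q: "0 < q" "q < 2" using r by (auto simp: q_def field_simps)
  obtain C where C: "C \<ge> 0"
    "\<And>w. w \<in> disc \<Longrightarrow> set_integrable lborel disc (\<lambda>z. cmod (z - w) powr (-q))"
    "\<And>w. w \<in> disc \<Longrightarrow> (LINT z:disc|lborel. cmod (z - w) powr (-q)) \<le> C"
    using disc_kernel_bound[OF q] by blast
  have C1: "set_integrable lborel disc (\<lambda>z. cmod (z - w) powr (-1))" if "w \<in> disc" for w
    by (rule disc_kernel_bound[of 1]) (use that in auto)
  have bound: "(LINT z:disc|lborel. \<bar>f z\<bar> * cmod (z - w) powr (-1)) \<le> (1 + C) * \<sigma>"
    if f: "continuous_on disc f" and w: "w \<in> disc" and \<sigma>: "\<sigma> > Lp_norm_disc (ereal r) f" for f w \<sigma>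
  proof -
    define s where "s = (LINT z:disc|lborel. \<bar>f z\<bar> powr r)"
    have s: "s \<ge> 0" unfolding s_def unfolding set_lebesgue_integral_def
    by (intro Bochner_Integration.integral_nonneg) auto
    have Lp: "Lp_norm_disc (ereal r) f = s powr (1 / r)" by (simp add: Lp_norm_disc_def s_def)
    have \<sigma>0: "\<sigma> > 0" using \<sigma> unfolding Lp by (metis powr_ge_zero le_less_trans)
    have "s = (s powr (1 / r)) powr r" using s r by (simp add: powr_powr)
    also have "\<dots> \<le> \<sigma> powr r" using \<sigma> r unfolding Lp by (intro powr_mono2) auto
    finally have s\<sigma>: "s / \<sigma> powr r \<le> 1" using \<sigma>0 by simp
    have fr: "set_integrable lborel disc (\<lambda>z. \<bar>f z\<bar> powr r / \<sigma> powr r)"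
      using r by (intro set_integrable_divide set_integrable_disc continuous_on_powr' continuous_on_rabs
          continuous_on_const f) auto
    have "(LINT z:disc|lborel. \<bar>f z\<bar> / \<sigma> * cmod (z - w) powr (-1))
      \<le> (LINT z:disc|lborel. \<bar>f z\<bar> powr r / \<sigma> powr r + cmod (z - w) powr (-q))"
    proof (rule set_integral_mono)
      show "set_integrable lborel disc (\<lambda>z. \<bar>f z\<bar> / \<sigma> * cmod (z - w) powr (-1))"
        by (intro set_integrable_continuous_mult continuous_intros f C1 w) (use \<sigma>0 in auto)
      show "set_integrable lborel disc (\<lambda>z. \<bar>f z\<bar> powr r / \<sigma> powr r + cmod (z - w) powr (-q))"
        by (intro set_integral_add fr C w)
      fix z
      have "\<bar>f z\<bar> / \<sigma> * cmod (z - w) powr (-1)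
        \<le> (\<bar>f z\<bar> / \<sigma>) powr r + (cmod (z - w) powr (-1)) powr (r / (r - 1))"
        using \<sigma>0 r by (intro mult_le_powr_add_powr) auto
      also have "(cmod (z - w) powr (-1)) powr (r / (r - 1)) = cmod (z - w) powr (-q)"
        unfolding powr_powr q_def by simp
      also have "(\<bar>f z\<bar> / \<sigma>) powr r = \<bar>f z\<bar> powr r / \<sigma> powr r"
        by (rule powr_divide)
      finally show "\<bar>f z\<bar> / \<sigma> * cmod (z - w) powr (-1) \<le> \<bar>f z\<bar> powr r / \<sigma> powr r + cmod (z - w) powr (-q)" .
    qed
    also have "\<dots> = s / \<sigma> powr r + (LINT z:disc|lborel. cmod (z - w) powr (-q))"
      using fr C(2)[OF w] by (simp add: s_def)
    also have "\<dots> \<le> 1 + C" using s\<sigma> C(3)[OF w] by (intro add_mono)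
    finally have "(LINT z:disc|lborel. \<bar>f z\<bar> * cmod (z - w) powr (-1)) / \<sigma> \<le> 1 + C"
      by (simp add: mult.commute flip: set_integral_divide_zero)
    then show ?thesis using \<sigma>0 by (simp add: divide_le_eq)
  qed
  have "(LINT z:disc|lborel. \<bar>f z\<bar> * cmod (z - w) powr (-1)) \<le> (1 + C) * Lp_norm_disc (ereal r) f"
    if "continuous_on disc f" "w \<in> disc" for f w
  proof -
    let ?I = "LINT z:disc|lborel. \<bar>f z\<bar> * cmod (z - w) powr (-1)"
    have "?I / (1 + C) \<le> Lp_norm_disc (ereal r) f"
    proof (rule dense_ge)
      fix \<sigma> assume "Lp_norm_disc (ereal r) f < \<sigma>"
      from bound[OF that this] show "?I / (1 + C) \<le> \<sigma>"
        using C(1) by (simp add: divide_le_eq mult.commute)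
    qed
    then show ?thesis using C(1) by (simp add: divide_le_eq mult.commute)
  qed
  then show ?thesis using that[of "1 + C"] C(1) by simp
qed

text \<open>\<open>real_of_ereal\<close> sends infinite values to 0, so the essential supremum must
  be shown finite: boundedness of f excludes \<infinity>, and \<open>\<bar>f z\<bar> \<le> E\<close>
  excludes the negative one.\<close>

lemma AE_le_Lp_norm_infinity:
  assumes f: "continuous_on disc f"
  shows "AE z in lborel. z \<in> disc \<longrightarrow> \<bar>f z\<bar> \<le> Lp_norm_disc \<infinity> f"
proof -
  let ?M = "restrict_space lborel disc"
  define E where "E = esssup ?M (\<lambda>w. ereal \<bar>f w\<bar>)"
  have "bounded (f ` disc)" using f by (auto intro!: compact_imp_bounded compact_continuous_image)
  then obtain M where M: "\<And>z. z \<in> disc \<Longrightarrow> \<bar>f z\<bar> \<le> M"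
    unfolding bounded_pos by (metis imageI real_norm_def)
  have "f \<in> borel_measurable (restrict_space borel disc)"
    by (rule borel_measurable_continuous_on_restrict[OF f])
  then have "f \<in> borel_measurable ?M"
    by (simp cong: measurable_cong_sets add: sets_restrict_space)
  then have "(\<lambda>w. ereal \<bar>f w\<bar>) \<in> borel_measurable ?M" by measurable
  then have "E \<le> ereal M"
    unfolding E_def using M by (intro esssup_I AE_I2) (auto simp: space_restrict_space)
  have "AE z in ?M. ereal \<bar>f z\<bar> \<le> E" unfolding E_def by (rule esssup_AE)
  then have "AE z in lborel. z \<in> disc \<longrightarrow> ereal \<bar>f z\<bar> \<le> E"
    by (simp add: AE_restrict_space_iff)
  then show ?thesis
  proof eventually_elim
    case (elim z)
    show ?case
    proof
      assume "z \<in> disc"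
      with elim have le: "ereal \<bar>f z\<bar> \<le> E" by blast
      with \<open>E \<le> ereal M\<close> obtain e where "E = ereal e" by (cases E) auto
      then show "\<bar>f z\<bar> \<le> Lp_norm_disc \<infinity> f" using le by (simp add: Lp_norm_disc_def flip: E_def)
    qed
  qed
qed

lemma integral_kernel_le_Lp_norm:
  assumes p: "2 < p"
  obtains C where "C > 0" "\<And>f w. continuous_on disc f \<Longrightarrow> w \<in> disc \<Longrightarrow>
    (LINT z:disc|lborel. \<bar>f z\<bar> * cmod (z - w) powr (-1)) \<le> C * Lp_norm_disc p f"
proof (cases p)
  case (real r)
  then show ?thesis using p integral_kernel_le_Lp_norm_finite[of r] that by auto
next
  case PInf
  obtain C where C: "C \<ge> 0"
    "\<And>w. w \<in> disc \<Longrightarrow> set_integrable lborel disc (\<lambda>z. cmod (z - w) powr (-1))"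
    "\<And>w. w \<in> disc \<Longrightarrow> (LINT z:disc|lborel. cmod (z - w) powr (-1)) \<le> C"
    using disc_kernel_bound[of 1] by auto
  \<comment> \<open>The kernel integral is bounded with exponent 1; \<open>1 + C\<close> makes the
    constant strictly positive.\<close>
  have "(LINT z:disc|lborel. \<bar>f z\<bar> * cmod (z - w) powr (-1)) \<le> (1 + C) * Lp_norm_disc \<infinity> f"
    if f: "continuous_on disc f" and w: "w \<in> disc" for f w
  proof -
    define s where "s = Lp_norm_disc \<infinity> f"
    have AE: "AE z in lborel. z \<in> disc \<longrightarrow> \<bar>f z\<bar> \<le> s"
      unfolding s_def by (rule AE_le_Lp_norm_infinity[OF f])
    \<comment> \<open>A negative \<open>s\<close> would contradict \<open>AE\<close> at almost every
      point of the disc, which has positive area.\<close>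
    have s: "s \<ge> 0"
    proof (rule ccontr)
      assume "\<not> s \<ge> 0"
      with AE have "AE z in lborel. z \<notin> disc" by (auto elim!: eventually_mono)
      then have "disc \<in> null_sets lborel" by (subst AE_iff_null_sets) auto
      then show False by (simp add: null_sets_def emeasure_cball unit_ball_vol_2)
    qed
    have "(LINT z:disc|lborel. \<bar>f z\<bar> * cmod (z - w) powr (-1)) \<le> (LINT z:disc|lborel. s * cmod (z - w) powr (-1))"
    proof (rule set_integral_mono_AE)
      show "set_integrable lborel disc (\<lambda>z. \<bar>f z\<bar> * cmod (z - w) powr (-1))"
        by (intro set_integrable_continuous_mult continuous_intros f C w)
      show "set_integrable lborel disc (\<lambda>z. s * cmod (z - w) powr (-1))"
        by (intro set_integrable_continuous_mult continuous_intros f C w)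
      show "AE z \<in> disc in lborel. \<bar>f z\<bar> * cmod (z - w) powr (-1) \<le> s * cmod (z - w) powr (-1)"
        using AE by eventually_elim (intro impI mult_right_mono, auto)
    qed
    also have "\<dots> = s * (LINT z:disc|lborel. cmod (z - w) powr (-1))" by (rule set_integral_mult_right)
    also have "\<dots> \<le> s * C" using C(3)[OF w] s by (rule mult_left_mono)
    also have "\<dots> \<le> (1 + C) * s" using s by (simp add: algebra_simps)
    finally show ?thesis by (simp add: s_def)
  qed
  then show ?thesis using that[of "1 + C"] C(1) PInf by simp
qed (use p in auto)

text \<open>This is the limit of \<open>weak_dbar_identity\<close> for
  \<open>test_fun l w (\<epsilon> n)\<close>: one mollifier concentrates at w, the reflected one
  vanishes, and the right-hand side has a bound independent of n.\<close>

lemma pointwise_torsion_bound: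
  assumes crit: "critical_normal_section X N1 N2" and w: "w \<in> ball 0 1"
  shows "cmod (complex_torsion N1 N2 w) * (LINT z|lborel. mollifier z)
    \<le> (LINT z:disc|lborel. \<bar>normal_curvature N1 N2 z\<bar> * cmod (z - w) powr (-1))"
proof -
  let ?\<Psi> = "complex_torsion N1 N2" and ?S = "normal_curvature N1 N2"
  define \<kappa> where "\<kappa> = (LINT z|lborel. mollifier z)"
  define I where "I = (LINT z:disc|lborel. \<bar>?S z\<bar> * cmod (z - w) powr (-1))"
  \<comment> \<open>With this weight \<open>Re (?\<Psi> w * l)\<close> is the squared modulus; one
    factor \<open>cmod l\<close> cancels at the end, and \<open>l = 0\<close> means that the torsion
    vanishes at w.\<close>
  define l where "l = cnj (?\<Psi> w)"
  define \<epsilon> where "\<epsilon> n = inverse (real (Suc n))" for n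
  have e: "\<epsilon> n > 0" "\<epsilon> \<longlonglongrightarrow> 0" for n
    unfolding \<epsilon>_def by (simp, rule LIMSEQ_inverse_real_of_nat)
  have wd: "w \<in> disc" and w1: "cmod w < 1" using w by auto
  have N: "orthonormal_normal_section X N1 N2" using crit by (simp add: critical_normal_section_def)
  note S = continuous_on_normal_curvature[OF N] and \<Psi> = continuous_on_complex_torsion[OF N]
  have re: "Re (of_real a * x - of_real b * y) = a * Re x - b * Re y" for a b x y by simp
  define f1 where "f1 z = 2 * Re (?\<Psi> z * l)" for z
  define f2 where "f2 z = 2 * Re (?\<Psi> z * (cnj l * w * z))" for z
  define k1 where "k1 n z = (\<epsilon> n)\<^sup>2 / ((cmod (z - w))\<^sup>2 + (\<epsilon> n)\<^sup>2)\<^sup>2" for n z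
  define k2 where "k2 n z = (\<epsilon> n)\<^sup>2 / ((cmod (1 - cnj w * z))\<^sup>2 + (\<epsilon> n)\<^sup>2)\<^sup>2" for n z
  have f: "continuous_on disc f1" "continuous_on disc f2"
    unfolding f1_def f2_def by (intro continuous_intros \<Psi>)+
  have k: "continuous_on disc (k1 n)" "continuous_on disc (k2 n)" for n
    unfolding k1_def k2_def using e(1)[of n]
    by (auto intro!: continuous_intros simp: add_nonneg_eq_0_iff)
  have bound: "(LINT z:disc|lborel. f1 z * k1 n z) - (LINT z:disc|lborel. f2 z * k2 n z) \<le> 2 * cmod l * I" for n
  proof -
    let ?F = "test_fun l w (\<epsilon> n)"
    have "(LINT z:disc|lborel. f1 z * k1 n z) - (LINT z:disc|lborel. f2 z * k2 n z)
      = (LINT z:disc|lborel. f1 z * k1 n z - f2 z * k2 n z)"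
      by (intro set_integral_diff(2)[symmetric] set_integrable_disc continuous_intros f k)
    also have "\<dots> = (LINT z:disc|lborel. Re (?\<Psi> z * (pd_u ?F z + \<i> * pd_v ?F z)))"
    proof (rule set_lebesgue_integral_cong; (intro allI impI)?)
      fix z assume z: "z \<in> disc"
      have "?\<Psi> z * (pd_u ?F z + \<i> * pd_v ?F z) =
        of_real (2 * k1 n z) * (?\<Psi> z * l) - of_real (2 * k2 n z) * (?\<Psi> z * (cnj l * w * z))"
        unfolding dbar_test_fun[OF e(1) z] k1_def k2_def by (simp add: algebra_simps)
      then show "f1 z * k1 n z - f2 z * k2 n z = Re (?\<Psi> z * (pd_u ?F z + \<i> * pd_v ?F z))"
        by (simp only: re f1_def f2_def) (simp only: mult_ac)
    qed simp
    also have "\<dots> = (LINT z:disc|lborel. ?S z * Im (?F z))"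
      by (rule weak_dbar_identity[OF crit C_disc_test_fun[OF e(1)] Im_test_fun_circle])
    also have "\<dots> \<le> (LINT z:disc|lborel. 2 * cmod l * (\<bar>?S z\<bar> * cmod (z - w) powr (-1)))"
    proof (rule set_integral_mono_AE)
      show "set_integrable lborel disc (\<lambda>z. ?S z * Im (?F z))"
        using C_disc_imp_continuous_on[OF C_disc_test_fun[OF e(1)[of n]]]
        by (intro set_integrable_disc continuous_intros S)
      have C1: "set_integrable lborel disc (\<lambda>z. cmod (z - w) powr (-1))"
        by (rule disc_kernel_bound[of 1]) (use wd in auto)
      show "set_integrable lborel disc (\<lambda>z. 2 * cmod l * (\<bar>?S z\<bar> * cmod (z - w) powr (-1)))"
        by (intro set_integrable_mult_right set_integrable_continuous_mult continuous_intros S C1)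
      \<comment> \<open>\<open>norm_test_fun_le\<close> excludes the pole, where its right-hand side
        would be 0 by the convention \<open>0 powr (-1) = 0\<close>.\<close>
      have "AE z in lborel. z \<noteq> w" by (rule AE_lborel_singleton)
      then show "AE z \<in> disc in lborel. ?S z * Im (?F z) \<le> 2 * cmod l * (\<bar>?S z\<bar> * cmod (z - w) powr (-1))"
      proof (eventually_elim, intro impI)
        fix z assume z: "z \<noteq> w" "z \<in> disc"
        have "?S z * Im (?F z) \<le> \<bar>?S z\<bar> * \<bar>Im (?F z)\<bar>" by (metis abs_ge_self abs_mult)
        also have "\<dots> \<le> \<bar>?S z\<bar> * (2 * cmod l * cmod (z - w) powr (-1))"
          using norm_test_fun_le[OF e(1) z(2) wd z(1), of l n] abs_Im_le_cmod[of "?F z"]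
          by (intro mult_left_mono) auto
        finally show "?S z * Im (?F z) \<le> 2 * cmod l * (\<bar>?S z\<bar> * cmod (z - w) powr (-1))"
          by (simp add: mult_ac)
      qed
    qed
    also have "\<dots> = 2 * cmod l * I" unfolding I_def by (rule set_integral_mult_right)
    finally show ?thesis .
  qed
  have lim1: "(\<lambda>n. LINT z:disc|lborel. f1 z * k1 n z) \<longlonglongrightarrow> f1 w * \<kappa>"
    unfolding k1_def \<kappa>_def by (rule mollifier_approximate_identity[OF f(1) w e])
  have lim2: "(\<lambda>n. LINT z:disc|lborel. f2 z * k2 n z) \<longlonglongrightarrow> (LINT z:disc|lborel. 0)"
    unfolding set_lebesgue_integral_def
  proof (rule integral_dominated_convergence)
    \<comment> \<open>Here w must be interior: the reflected denominator stays away from zero, so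
      \<open>k2 n\<close> is of order \<open>(\<epsilon> n)^2\<close> uniformly on the disc.\<close>
    have pos: "cmod (1 - cnj w * z) \<ge> 1 - cmod w" if "z \<in> disc" for z
    proof -
      have "1 - cmod w \<le> 1 - cmod (cnj w * z)"
        using that mult_left_mono[of "cmod z" 1 "cmod w"] by (simp add: norm_mult)
      also have "\<dots> \<le> cmod (1 - cnj w * z)" using norm_triangle_ineq2[of 1 "cnj w * z"] by simp
      finally show ?thesis .
    qed
    let ?c = "1 / ((1 - cmod w)\<^sup>2)\<^sup>2"
    have k2_le: "\<bar>k2 n z\<bar> \<le> (\<epsilon> n)\<^sup>2 * ?c" if "z \<in> disc" for n z
    proof -
      have "(1 - cmod w)\<^sup>2 \<le> (cmod (1 - cnj w * z))\<^sup>2"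
        using pos[OF that] w1 by (intro power_mono) auto
      then have "((1 - cmod w)\<^sup>2)\<^sup>2 \<le> ((cmod (1 - cnj w * z))\<^sup>2 + (\<epsilon> n)\<^sup>2)\<^sup>2"
        by (intro power_mono) (auto intro: add_increasing2)
      then have "(\<epsilon> n)\<^sup>2 / ((cmod (1 - cnj w * z))\<^sup>2 + (\<epsilon> n)\<^sup>2)\<^sup>2 \<le> (\<epsilon> n)\<^sup>2 / ((1 - cmod w)\<^sup>2)\<^sup>2"
        using w1 e(1)[of n] by (intro divide_left_mono) (auto intro!: mult_pos_pos add_nonneg_pos)
      then show ?thesis by (simp add: k2_def)
    qed
    show "integrable lborel (\<lambda>z. indicator disc z *\<^sub>R (\<bar>f2 z\<bar> * ?c))"
      by (intro borel_integrable_compact compact_cball continuous_intros f)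
    show "(\<lambda>z. indicator disc z *\<^sub>R (f2 z * k2 n z)) \<in> borel_measurable lborel" for n
      using set_integrable_disc[OF continuous_on_mult[OF f(2) k(2)[of n]]]
      unfolding set_integrable_def by auto
    show "AE z in lborel. norm (indicator disc z *\<^sub>R (f2 z * k2 n z)) \<le> indicator disc z *\<^sub>R (\<bar>f2 z\<bar> * ?c)" for n
    proof (rule AE_I2)
      fix z
      have "(\<epsilon> n)\<^sup>2 \<le> 1" by (simp add: \<epsilon>_def power_le_one field_simps)
      then have "(\<epsilon> n)\<^sup>2 * ?c \<le> 1 * ?c" by (intro mult_right_mono) auto
      then have "\<bar>f2 z\<bar> * \<bar>k2 n z\<bar> \<le> \<bar>f2 z\<bar> * ?c" if "z \<in> disc"
        using k2_le[OF that, of n] by (intro mult_left_mono) linarith+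
      then show "norm (indicator disc z *\<^sub>R (f2 z * k2 n z)) \<le> indicator disc z *\<^sub>R (\<bar>f2 z\<bar> * ?c)"
        by (auto simp: indicator_def abs_mult)
    qed
    show "AE z in lborel. (\<lambda>n. indicator disc z *\<^sub>R (f2 z * k2 n z)) \<longlonglongrightarrow> indicator disc z *\<^sub>R 0"
    proof (rule AE_I2)
      fix z
      show "(\<lambda>n. indicator disc z *\<^sub>R (f2 z * k2 n z)) \<longlonglongrightarrow> indicator disc z *\<^sub>R 0"
      proof (cases "z \<in> disc")
        case True
        have "(\<lambda>n. (\<epsilon> n)\<^sup>2 * ?c) \<longlonglongrightarrow> 0\<^sup>2 * ?c" by (intro tendsto_intros e)
        then have "(\<lambda>n. (\<epsilon> n)\<^sup>2 * ?c) \<longlonglongrightarrow> 0" by simp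
        then have "(\<lambda>n. k2 n z) \<longlonglongrightarrow> 0"
          by (rule Lim_null_comparison[rotated]) (use k2_le[OF True] in auto)
        then have "(\<lambda>n. f2 z * k2 n z) \<longlonglongrightarrow> f2 z * 0" by (intro tendsto_intros)
        then show ?thesis using True by simp
      qed simp
    qed
  qed simp
  have "f1 w * \<kappa> - 0 \<le> 2 * cmod l * I"
    using tendsto_diff[OF lim1 lim2] bound by (intro LIMSEQ_le_const2) auto
  moreover have "f1 w = 2 * cmod l * cmod (?\<Psi> w)"
    by (simp add: f1_def l_def complex_mult_cnj cmod_power2[symmetric] power2_eq_square[symmetric] flip: complex_norm_square)
  ultimately have *: "2 * cmod l * (cmod (?\<Psi> w) * \<kappa>) \<le> 2 * cmod l * I" by (simp add: mult_ac)
  have "I \<ge> 0" unfolding I_def unfolding set_lebesgue_integral_def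
    by (intro Bochner_Integration.integral_nonneg) auto
  show ?thesis
  proof (cases "l = 0")
    case True
    then show ?thesis using \<open>I \<ge> 0\<close> by (simp add: l_def I_def)
  next
    case False
    then show ?thesis using * by (simp add: I_def \<kappa>_def)
  qed
qed

theorem mainTheorem1:
  fixes p :: ereal
  assumes "2 < p"
  shows "\<exists>c::real. c > 0 \<and>
    (\<forall>X N1 N2 :: complex \<Rightarrow> real ^ 4.
       conformal_immersion X \<longrightarrow> critical_normal_section X N1 N2 \<longrightarrow>
       (\<forall>w\<in>disc. cmod (complex_torsion N1 N2 w) \<le> c * Lp_norm_disc p (normal_curvature N1 N2)))"
proof -
  obtain C where C: "C > 0" "\<And>f w. continuous_on disc f \<Longrightarrow> w \<in> disc \<Longrightarrow>
    (LINT z:disc|lborel. \<bar>f z\<bar> * cmod (z - w) powr (-1)) \<le> C * Lp_norm_disc p f"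
    using integral_kernel_le_Lp_norm[OF assms] by blast
  define \<kappa> where "\<kappa> = (LINT z|lborel. mollifier z)"
  have \<kappa>: "\<kappa> > 0" unfolding \<kappa>_def by (rule integral_mollifier_pos)
  \<comment> \<open>The lower bound \<open>1 - cmod w\<close> used for the reflected term
    degenerates at the circle but does not enter the final estimate, whose constant is uniform; so
    it passes to the closure.\<close>
  have "cmod (complex_torsion N1 N2 w) \<le> C / \<kappa> * Lp_norm_disc p (normal_curvature N1 N2)"
    if crit: "critical_normal_section X N1 N2" and w: "w \<in> disc" for X N1 N2 w
  proof (rule continuous_on_closure_norm_le[where s = "ball 0 1" and f = "complex_torsion N1 N2"])
    have N: "orthonormal_normal_section X N1 N2" using crit by (simp add: critical_normal_section_def)
    show "continuous_on (closure (ball 0 1)) (complex_torsion N1 N2)"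
      using continuous_on_complex_torsion[OF N] by simp
    show "w \<in> closure (ball 0 1)" using w by simp
    show "\<forall>y\<in>ball 0 1. cmod (complex_torsion N1 N2 y) \<le> C / \<kappa> * Lp_norm_disc p (normal_curvature N1 N2)"
    proof
      fix y :: complex assume y: "y \<in> ball 0 1"
      then have "cmod (complex_torsion N1 N2 y) * \<kappa> \<le> C * Lp_norm_disc p (normal_curvature N1 N2)"
        using pointwise_torsion_bound[OF crit y] C(2)[OF continuous_on_normal_curvature[OF N], of y]
        by (simp add: \<kappa>_def)
      then show "cmod (complex_torsion N1 N2 y) \<le> C / \<kappa> * Lp_norm_disc p (normal_curvature N1 N2)"
        using \<kappa> by (simp add: field_simps)
    qed
  qed
  then show ?thesis using C(1) \<kappa> by (intro exI[of _ "C / \<kappa>"]) auto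
qed

end
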